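(* Let $\mu$ be a Borel probability measure on $\mathbb{R}$ with $m_1(\mu)=0$, $m_2(\mu)=1$ and $\mathrm{supp}(\mu)\subset[-K,K]$ for some $K>0$. For $n\ge1$ let $\mu_n=D_{1/\sqrt{n}}\,\mu^{\uplus n}$. Then for every $n$ with $\sqrt{n}>K$: (1) $\mathrm{supp}(\mu_n)\subset[-\frac{K}{\sqrt n},\frac{K}{\sqrt n}]\cup\{x_1,x_2\}$ for some real $x_1,x_2$ with $|-1-x_1|\le \frac{K}{\sqrt n}$ and $|1-x_2|\le\frac{K}{\sqrt n}$; (2) with $p=\mu_n(\{x_1\})$, $q=\mu_n(\{x_2\})$ and $r=\mu_n([-\frac{K}{\sqrt n},\frac{K}{\sqrt n}])$, one has $p,q\in[\frac12-\frac{2K}{\sqrt n},\frac12+\frac{K}{2\sqrt n}]$ and $r<\frac{4K}{\sqrt n}$. In particular $L(\mu_n,\mathbf{b})\le \frac{2K}{\sqrt n}$.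
   Context: $m_k(\mu)=\int x^k d\mu$. For a Borel probability measure $\mu$ on $\mathbb{R}$ and $a>0$, $D_a\mu(B)=\mu(a^{-1}B)$. The Cauchy transform is $G_\mu(z)=\int_{\mathbb{R}}\frac{1}{z-t}\,d\mu(t)$ for $z\in\mathbb{C}^+$, $F_\mu=1/G_\mu$, $K_\mu(z)=z-F_\mu(z)$. The Boolean convolution $\mu\uplus\nu$ is the unique probability measure with $K_{\mu\uplus\nu}=K_\mu+K_\nu$ on $\mathbb{C}^+$; $\mu^{\uplus n}$ is the $n$-fold Boolean convolution power. $\mathbf{b}=\frac12\delta_{-1}+\frac12\delta_1$. The Lévy distance between probability measures with distribution functions $F,G$ is $L=\inf\{\epsilon>0: F(x-\epsilon)-\epsilon\le G(x)\le F(x+\epsilon)+\epsilon\ \forall x\in\mathbb{R}\}$. *)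

theory Defs
  imports "HOL-Probability.Probability"
begin

definition moment :: "real measure \<Rightarrow> nat \<Rightarrow> real" where
  "moment M k = (\<integral>x. x ^ k \<partial>M)"

definition borel_prob :: "real measure \<Rightarrow> bool" where
  "borel_prob M \<longleftrightarrow> sets M = sets borel \<and> prob_space M"

definition msupport :: "real measure \<Rightarrow> real set" where
  "msupport M = {x. \<forall>e>0. emeasure M (ball x e) > 0}"

definition dilate :: "real \<Rightarrow> real measure \<Rightarrow> real measure" where
  "dilate a M = distr M borel (\<lambda>x. a * x)"

definition cauchy_transform :: "real measure \<Rightarrow> complex \<Rightarrow> complex" where
  "cauchy_transform M z = (\<integral>t. 1 / (z - complex_of_real t) \<partial>M)"

definition F_transform :: "real measure \<Rightarrow> complex \<Rightarrow> complex" where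
  "F_transform M z = 1 / cauchy_transform M z"

definition K_transform :: "real measure \<Rightarrow> complex \<Rightarrow> complex" where
  "K_transform M z = z - F_transform M z"

definition boolean_conv :: "real measure \<Rightarrow> real measure \<Rightarrow> real measure" where
  "boolean_conv M N = (THE R. borel_prob R \<and>
     (\<forall>z. Im z > 0 \<longrightarrow> K_transform R z = K_transform M z + K_transform N z))"

text \<open>n-fold Boolean convolution power (delta_0, whose K-transform is 0, is the unit).\<close>
fun boolean_power :: "real measure \<Rightarrow> nat \<Rightarrow> real measure" where
  "boolean_power M 0 = return borel 0"
| "boolean_power M (Suc n) = boolean_conv (boolean_power M n) M"

definition bern_sym :: "real measure" where
  "bern_sym = measure_pmf (pmf_of_set {-1, 1})"

definition levy_dist :: "real measure \<Rightarrow> real measure \<Rightarrow> real" where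
  "levy_dist M N = Inf {e. e > 0 \<and> (\<forall>x. measure M {..x - e} - e \<le> measure N {..x}
        \<and> measure N {..x} \<le> measure M {..x + e} + e)}"

end

theory Submission
  imports Defs "HOL-Complex_Analysis.Complex_Analysis"
begin

text \<open>
  Write \<open>G\<close>, \<open>F\<close>, \<open>K\<close> for the transforms of \<open>\<mu>\<close>. Bessel's inequality for the orthonormal pair \<open>1, t\<close>
  in \<open>L\<^sup>2(\<mu>)\<close>, applied to \<open>1 / (z - t)\<close>, gives \<open>Im z * |K z|\<^sup>2 \<le> - Im (K z)\<close>, so \<open>|K z| \<le> 1 / Im z\<close>.
  Hence \<open>g z = 1 / (z - n * K z)\<close> maps the upper half plane to the closed lower one and
  \<open>|z * g z - 1| \<le> n / (Im z)\<^sup>2\<close>. Such a function is a Cauchy transform: by Cauchy's formula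
  \<open>z \<mapsto> g (z + \<i> y)\<close> is the Cauchy transform of the density \<open>- Im g(x + \<i> y) / \<pi>\<close>, and Helly's selection
  theorem yields a limit as \<open>y \<rightarrow> 0\<close>. Together with Stieltjes inversion this shows that the Boolean powers
  exist, are unique, and have \<open>K\<close>-transform \<open>n * K\<close>.

  Let \<open>s = sqrt n\<close>, let \<open>R\<close> be the Boolean power before dilation, and let \<open>b\<close> bound the support of \<open>\<mu>\<close>.
  The function \<open>\<phi> x = x - s\<^sup>2 * K x\<close> is real and strictly increasing on \<open>(b, \<infinity>)\<close>, and
  \<open>1 / (x + b) \<le> K x \<le> 1 / (x - b)\<close> there. So \<open>\<phi>\<close> has at most one zero \<open>X\<close>, which lies within \<open>b\<close> of \<open>s\<close>.
  Away from \<open>X\<close> the Cauchy transform of \<open>R\<close> has real boundary values, so \<open>R\<close> has no mass there, and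
  \<open>R {X} = 1 / \<phi>' X\<close>. Second-moment estimates for \<open>1 / (X - t)\<close> bound \<open>\<phi>' X\<close> on both sides. The other half
  line follows by reflection.
\<close>

section \<open>The Cauchy transform away from the support\<close>

definition cauchy_kernel :: "complex \<Rightarrow> real \<Rightarrow> complex" where
  "cauchy_kernel z t = 1 / (z - complex_of_real t)"

lemma cauchy_transform_kernel: "cauchy_transform M z = (\<integral>t. cauchy_kernel z t \<partial>M)"
  by (simp add: cauchy_transform_def cauchy_kernel_def)

lemma kernel_of_real: "cauchy_kernel (of_real x) t = of_real (1 / (x - t))"
  by (simp add: cauchy_kernel_def)

lemma kernel_measurable [measurable]: "cauchy_kernel z \<in> borel_measurable borel"
  unfolding cauchy_kernel_def by measurable

text \<open>Positive distance from the support, phrased almost everywhere so that non-real points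
  and real points beyond the support fall under the same lemmas. It makes the kernel essentially
  bounded.\<close>

definition off_measure :: "real measure \<Rightarrow> complex \<Rightarrow> bool" where
  "off_measure M z \<longleftrightarrow> (\<exists>d>0. AE t in M. d \<le> cmod (z - of_real t))"

lemma off_measureI_Im: "Im z \<noteq> 0 \<Longrightarrow> off_measure M z"
  unfolding off_measure_def
  by (rule exI[of _ "\<bar>Im z\<bar>"]) (auto intro!: AE_I2 order.trans[OF _ abs_Im_le_cmod])

locale borel_distribution = prob_space M for M :: "real measure" +
  assumes sets_M [measurable_cong, simp]: "sets M = sets borel"
begin

lemma space_M [simp]: "space M = UNIV"
  using sets_eq_imp_space_eq[OF sets_M] by simp

lemma integrable_bound:
  fixes f :: "real \<Rightarrow> 'a::{banach,second_countable_topology}"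
  assumes "f \<in> borel_measurable borel" "AE t in M. norm (f t) \<le> B"
  shows "integrable M f"
  by (rule integrable_const_bound[OF assms(2)]) (use assms(1) in measurable)

lemma kernel_integrable: assumes "off_measure M z" shows "integrable M (cauchy_kernel z)"
proof -
  obtain d where d: "d > 0" "AE t in M. d \<le> cmod (z - of_real t)"
    using assms by (auto simp: off_measure_def)
  have "AE t in M. norm (cauchy_kernel z t) \<le> 1 / d"
    using d(2) by eventually_elim (use d(1) in \<open>auto simp: cauchy_kernel_def norm_divide intro!: frac_le\<close>)
  then show ?thesis by (intro integrable_bound) auto
qed

lemma kernel_mult_integrable:
  assumes "off_measure M z" "off_measure M w" shows "integrable M (\<lambda>t. cauchy_kernel z t * cauchy_kernel w t)"
proof -
  obtain d where d: "d > 0" "AE t in M. d \<le> cmod (z - of_real t)"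
    using assms by (auto simp: off_measure_def)
  obtain e where e: "e > 0" "AE t in M. e \<le> cmod (w - of_real t)"
    using assms by (auto simp: off_measure_def)
  have "AE t in M. norm (cauchy_kernel z t * cauchy_kernel w t) \<le> 1 / (d * e)"
    using d(2) e(2)
    by eventually_elim (use d(1) e(1) in \<open>auto simp: cauchy_kernel_def norm_divide norm_mult intro!: frac_le mult_mono\<close>)
  then show ?thesis by (intro integrable_bound) auto
qed

lemma off_measure_AE_ne:
  assumes "off_measure M z" shows "AE t in M. z \<noteq> of_real t"
proof -
  obtain d where d: "d > 0" "AE t in M. d \<le> cmod (z - of_real t)"
    using assms by (auto simp: off_measure_def)
  show ?thesis using d(2) by eventually_elim (use d(1) in auto)
qed

text \<open>Once \<open>s n\<close> is within d / 2 of \<open>z\<close>, its distance to almost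
  every \<open>t\<close> is at least d / 2, so the tail of the sequence is dominated by a constant.
  This one limit later gives continuity, the derivative and the weight of the atom.\<close>

lemma tendsto_kernel_mult:
  assumes z: "off_measure M z" and w: "off_measure M w" and s: "s \<longlonglongrightarrow> z"
  shows "(\<lambda>n. \<integral>t. cauchy_kernel (s n) t * cauchy_kernel w t \<partial>M) \<longlonglongrightarrow> (\<integral>t. cauchy_kernel z t * cauchy_kernel w t \<partial>M)"
proof -
  obtain d where d: "d > 0" "AE t in M. d \<le> cmod (z - of_real t)"
    using z by (auto simp: off_measure_def)
  obtain e where e: "e > 0" "AE t in M. e \<le> cmod (w - of_real t)"
    using w by (auto simp: off_measure_def)
  obtain N where N: "\<And>n. n \<ge> N \<Longrightarrow> dist (s n) z < d / 2"
    using s d(1) by (meson half_gt_zero lim_sequentially)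
  have s': "(\<lambda>n. s (n + N)) \<longlonglongrightarrow> z" using s by (rule LIMSEQ_ignore_initial_segment)
  have "(\<lambda>n. \<integral>t. cauchy_kernel (s (n + N)) t * cauchy_kernel w t \<partial>M) \<longlonglongrightarrow> (\<integral>t. cauchy_kernel z t * cauchy_kernel w t \<partial>M)"
  proof (rule integral_dominated_convergence[where w = "\<lambda>_. 1 / (d / 2 * e)"])
    show "AE t in M. norm (cauchy_kernel (s (n + N)) t * cauchy_kernel w t) \<le> 1 / (d / 2 * e)" for n
      using d(2) e(2)
    proof eventually_elim
      case (elim t)
      have "cmod (z - of_real t) \<le> cmod (z - s (n + N)) + cmod (s (n + N) - of_real t)"
        by (metis diff_add_cancel norm_triangle_ineq add_diff_eq)
      then have "d / 2 \<le> cmod (s (n + N) - of_real t)"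
        using N[of "n + N"] elim by (simp add: dist_norm norm_minus_commute)
      then show ?case using d(1) e(1) elim
        by (auto simp: cauchy_kernel_def norm_divide norm_mult simp del: times_divide_eq_left intro!: frac_le mult_mono)
    qed
    show "AE t in M. (\<lambda>n. cauchy_kernel (s (n + N)) t * cauchy_kernel w t) \<longlonglongrightarrow> cauchy_kernel z t * cauchy_kernel w t"
      using off_measure_AE_ne[OF z] off_measure_AE_ne[OF w]
      by eventually_elim (unfold cauchy_kernel_def, intro tendsto_intros s', auto)
  qed auto
  then show ?thesis by (rule LIMSEQ_offset)
qed

text \<open>Integrated form of the resolvent identity 1 / (z - t) - 1 / (w - t) = (w - z) / ((z - t)
  (w - t)).\<close>

lemma cauchy_transform_diff:
  assumes "off_measure M z" "off_measure M w"
  shows "cauchy_transform M z - cauchy_transform M w = (w - z) * (\<integral>t. cauchy_kernel z t * cauchy_kernel w t \<partial>M)"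
proof -
  have "cauchy_transform M z - cauchy_transform M w = (\<integral>t. cauchy_kernel z t - cauchy_kernel w t \<partial>M)"
    by (simp add: cauchy_transform_kernel kernel_integrable assms)
  also have "\<dots> = (\<integral>t. (w - z) * (cauchy_kernel z t * cauchy_kernel w t) \<partial>M)"
  proof (rule integral_cong_AE)
    show "AE t in M. cauchy_kernel z t - cauchy_kernel w t = (w - z) * (cauchy_kernel z t * cauchy_kernel w t)"
      using off_measure_AE_ne[OF assms(1)] off_measure_AE_ne[OF assms(2)]
      by eventually_elim (simp add: cauchy_kernel_def field_simps)
  qed auto
  finally show ?thesis by simp
qed

lemma tendsto_cauchy_transform:
  assumes "off_measure M z" "\<And>n. off_measure M (s n)" "s \<longlonglongrightarrow> z"
  shows "(\<lambda>n. cauchy_transform M (s n)) \<longlonglongrightarrow> cauchy_transform M z"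
proof -
  have "(\<lambda>n. cauchy_transform M z + (z - s n) * (\<integral>t. cauchy_kernel (s n) t * cauchy_kernel z t \<partial>M))
     \<longlonglongrightarrow> cauchy_transform M z + (z - z) * (\<integral>t. cauchy_kernel z t * cauchy_kernel z t \<partial>M)"
    by (intro tendsto_intros tendsto_kernel_mult assms)
  moreover have "cauchy_transform M z + (z - s n) * (\<integral>t. cauchy_kernel (s n) t * cauchy_kernel z t \<partial>M) = cauchy_transform M (s n)" for n
    using cauchy_transform_diff[OF assms(2)[of n] assms(1)] by (simp add: algebra_simps)
  ultimately show ?thesis by simp
qed

text \<open>By the resolvent identity each difference quotient is exactly minus the integral of a
  product of two kernels. The open set \<open>A\<close> keeps the points near \<open>z\<close> off
  the measure.\<close>

lemma cauchy_transform_has_derivative: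
  assumes "open A" "\<And>z. z \<in> A \<Longrightarrow> off_measure M z" "z \<in> A"
  shows "(cauchy_transform M has_field_derivative - (\<integral>t. cauchy_kernel z t * cauchy_kernel z t \<partial>M)) (at z)"
  unfolding has_field_derivative_iff
proof (subst tendsto_at_iff_sequentially, intro allI impI)
  fix s :: "nat \<Rightarrow> complex"
  assume s: "\<forall>i. s i \<in> UNIV - {z}" "s \<longlonglongrightarrow> z"
  have "(\<lambda>n. - (\<integral>t. cauchy_kernel (s n) t * cauchy_kernel z t \<partial>M)) \<longlonglongrightarrow> - (\<integral>t. cauchy_kernel z t * cauchy_kernel z t \<partial>M)"
    by (intro tendsto_intros tendsto_kernel_mult assms s)
  moreover have "\<forall>\<^sub>F n in sequentially. s n \<in> A"
    using s(2) assms(1,3) by (rule topological_tendstoD)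
  then have "\<forall>\<^sub>F n in sequentially. - (\<integral>t. cauchy_kernel (s n) t * cauchy_kernel z t \<partial>M) =
       (cauchy_transform M (s n) - cauchy_transform M z) / (s n - z)"
  proof eventually_elim
    case (elim n)
    have "s n \<noteq> z" using s(1) by auto
    then show ?case
      using cauchy_transform_diff[of "s n" z] elim assms by (auto simp: field_simps)
  qed
  ultimately show "((\<lambda>y. (cauchy_transform M y - cauchy_transform M z) / (y - z)) \<circ> s)
        \<longlonglongrightarrow> - (\<integral>t. cauchy_kernel z t * cauchy_kernel z t \<partial>M)"
    unfolding o_def by (rule Lim_transform_eventually)
qed

lemma cauchy_transform_holomorphic: "cauchy_transform M holomorphic_on {z. Im z > 0}"
  unfolding holomorphic_on_def
proof
  fix z assume z: "z \<in> {z. Im z > 0}"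
  have "(cauchy_transform M has_field_derivative - (\<integral>t. cauchy_kernel z t * cauchy_kernel z t \<partial>M)) (at z)"
    by (rule cauchy_transform_has_derivative[OF open_halfspace_Im_gt _ z]) (auto intro: off_measureI_Im)
  then show "cauchy_transform M field_differentiable (at z within {z. Im z > 0})"
    using field_differentiable_at_within field_differentiable_def by blast
qed

lemma Im_kernel: "Im (cauchy_kernel z t) = - (Im z * (cmod (cauchy_kernel z t))\<^sup>2)"
proof (cases "z = of_real t")
  case False
  have "Im (cauchy_kernel z t) = - (Im z) / (cmod (z - of_real t))\<^sup>2"
    by (simp add: cauchy_kernel_def Im_divide cmod_power2)
  then show ?thesis by (simp add: cauchy_kernel_def norm_divide power_divide)
qed (simp add: cauchy_kernel_def)

lemma kernel_norm2_integrable: 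
  assumes "off_measure M z" shows "integrable M (\<lambda>t. (cmod (cauchy_kernel z t))\<^sup>2)"
proof -
  have "integrable M (\<lambda>t. norm (cauchy_kernel z t * cauchy_kernel z t))"
    by (intro integrable_norm kernel_mult_integrable assms)
  then show ?thesis by (simp add: norm_mult power2_eq_square)
qed

lemma Im_cauchy_transform:
  assumes "off_measure M z"
  shows "Im (cauchy_transform M z) = - (Im z * (\<integral>t. (cmod (cauchy_kernel z t))\<^sup>2 \<partial>M))"
proof -
  have "Im (cauchy_transform M z) = (\<integral>t. Im (cauchy_kernel z t) \<partial>M)"
    by (simp add: cauchy_transform_kernel kernel_integrable assms)
  then show ?thesis by (simp add: Im_kernel)
qed

end

section \<open>Mean zero and unit variance: Bessel's inequality and bounds on the
  K-transform\<close>

locale standardized_distribution = borel_distribution M for M +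
  assumes moment1: "moment M 1 = 0" and moment2: "moment M 2 = 1"
begin

text \<open>A non-integrable function has Bochner integral 0, so a second moment equal to 1 already
  forces integrability.\<close>

lemma integrable_sq: "integrable M (\<lambda>t. t\<^sup>2)"
  using moment2 not_integrable_integral_eq by (fastforce simp: moment_def)

lemma integrable_id: "integrable M (\<lambda>t. t)"
proof (rule Bochner_Integration.integrable_bound[where f = "\<lambda>t. 1 + t\<^sup>2"])
  show "AE t in M. norm t \<le> norm (1 + t\<^sup>2)"
  proof (rule AE_I2)
    fix t :: real
    have "0 \<le> (\<bar>t\<bar> - 1)\<^sup>2" by simp
    then have "2 * \<bar>t\<bar> \<le> 1 + t\<^sup>2" by (simp add: power2_diff)
    then show "norm t \<le> norm (1 + t\<^sup>2)" by simp
  qed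
qed (auto intro: integrable_sq)

lemma integral_id: "(\<integral>t. t \<partial>M) = 0" and integral_sq: "(\<integral>t. t\<^sup>2 \<partial>M) = 1"
  using moment1 moment2 by (simp_all add: moment_def)

lemma integrable_mult_id:
  fixes f :: "real \<Rightarrow> real"
  assumes "f \<in> borel_measurable borel" "AE t in M. \<bar>f t\<bar> \<le> B"
  shows "integrable M (\<lambda>t. t * f t)"
proof (rule Bochner_Integration.integrable_bound[where f = "\<lambda>t. B * t"])
  show "AE t in M. norm (t * f t) \<le> norm (B * t)"
    using assms(2)
  proof eventually_elim
    case (elim t)
    then have "\<bar>f t\<bar> \<le> \<bar>B\<bar>" by simp
    then have "\<bar>t\<bar> * \<bar>f t\<bar> \<le> \<bar>t\<bar> * \<bar>B\<bar>" by (rule mult_left_mono) simp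
    then show ?case by (simp add: abs_mult mult.commute)
  qed
next
    show "(\<lambda>t. t * f t) \<in> borel_measurable M" using assms(1) by measurable
    show "integrable M (\<lambda>t. B * t)" by (rule integrable_mult_right[OF integrable_id])
  qed

text \<open>The moment conditions say that 1 and t are orthonormal in L^2; the inequality is the
  non-negativity of the squared distance from \<open>f\<close> to its projection a + b t.\<close>

lemma bessel:
  fixes f :: "real \<Rightarrow> real"
  assumes f [measurable]: "f \<in> borel_measurable borel" and B: "AE t in M. \<bar>f t\<bar> \<le> B"
  shows "(\<integral>t. f t \<partial>M)\<^sup>2 + (\<integral>t. t * f t \<partial>M)\<^sup>2 \<le> (\<integral>t. (f t)\<^sup>2 \<partial>M)"
proof -
  define a b where "a = (\<integral>t. f t \<partial>M)" and "b = (\<integral>t. t * f t \<partial>M)"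
  have i1: "integrable M f" by (rule integrable_bound) (use B in auto)
  have "AE t in M. norm ((f t)\<^sup>2) \<le> B\<^sup>2"
    using B by eventually_elim (simp add: abs_le_square_iff[symmetric])
  then have i2: "integrable M (\<lambda>t. (f t)\<^sup>2)" by (intro integrable_bound) auto
  note i = i1 i2 integrable_mult_id[OF f B] integrable_id integrable_sq
  have "0 \<le> (\<integral>t. (f t - (a + b * t))\<^sup>2 \<partial>M)" by simp
  also have "\<dots> = (\<integral>t. (f t)\<^sup>2 - 2 * a * f t - 2 * b * (t * f t) + (a\<^sup>2 + 2 * a * b * t + b\<^sup>2 * t\<^sup>2) \<partial>M)"
    by (rule Bochner_Integration.integral_cong) (auto simp: power2_eq_square algebra_simps)
  also have "\<dots> = (\<integral>t. (f t)\<^sup>2 \<partial>M) - 2 * a * a - 2 * b * b + (a\<^sup>2 + b\<^sup>2)"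
    using i by (simp add: integral_id integral_sq a_def b_def prob_space[simplified])
  finally show ?thesis by (simp add: a_def b_def power2_eq_square)
qed

text \<open>The identity t / (z - t) = z / (z - t) - 1 expresses the coefficient of the kernel along
  t through the Cauchy transform.\<close>

lemma t_kernel:
  assumes "off_measure M z"
  shows "integrable M (\<lambda>t. of_real t * cauchy_kernel z t)"
    and "(\<integral>t. of_real t * cauchy_kernel z t \<partial>M) = z * cauchy_transform M z - 1"
proof -
  have ae: "AE t in M. z * cauchy_kernel z t - 1 = of_real t * cauchy_kernel z t"
    using off_measure_AE_ne[OF assms] by eventually_elim (simp add: cauchy_kernel_def field_simps)
  have i: "integrable M (\<lambda>t. z * cauchy_kernel z t - 1)"
    using kernel_integrable[OF assms] by simp
  show "integrable M (\<lambda>t. of_real t * cauchy_kernel z t)"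
    using integrable_cong_AE[of "\<lambda>t. z * cauchy_kernel z t - 1" M "\<lambda>t. of_real t * cauchy_kernel z t"] ae i by auto
  have "(\<integral>t. of_real t * cauchy_kernel z t \<partial>M) = (\<integral>t. z * cauchy_kernel z t - 1 \<partial>M)"
    by (rule integral_cong_AE) (use ae in auto)
  then show "(\<integral>t. of_real t * cauchy_kernel z t \<partial>M) = z * cauchy_transform M z - 1"
    by (simp add: cauchy_transform_kernel kernel_integrable assms prob_space[simplified])
qed

text \<open>The real inequality is applied to the real and imaginary parts of the kernel separately,
  and the results are added.\<close>

lemma bessel_kernel:
  assumes "off_measure M z"
  shows "(cmod (cauchy_transform M z))\<^sup>2 + (cmod (z * cauchy_transform M z - 1))\<^sup>2
     \<le> (\<integral>t. (cmod (cauchy_kernel z t))\<^sup>2 \<partial>M)"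
proof -
  obtain d where d: "d > 0" "AE t in M. d \<le> cmod (z - of_real t)"
    using assms by (auto simp: off_measure_def)
  have b: "AE t in M. cmod (cauchy_kernel z t) \<le> 1 / d"
    using d(2) by eventually_elim (use d(1) in \<open>auto simp: cauchy_kernel_def norm_divide intro!: frac_le\<close>)
  have bR: "AE t in M. \<bar>Re (cauchy_kernel z t)\<bar> \<le> 1 / d" and bI: "AE t in M. \<bar>Im (cauchy_kernel z t)\<bar> \<le> 1 / d"
    using b by (eventually_elim, meson abs_Re_le_cmod abs_Im_le_cmod order.trans)+
  have sq: "norm (r\<^sup>2) \<le> (1/d)\<^sup>2" if "\<bar>r\<bar> \<le> 1/d" for r :: real
    using power_mono[OF that, of 2] by simp
  have "AE t in M. norm ((Re (cauchy_kernel z t))\<^sup>2) \<le> (1/d)\<^sup>2"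
    using bR by eventually_elim (rule sq)
  note i1 = integrable_bound[OF _ this]
  have "AE t in M. norm ((Im (cauchy_kernel z t))\<^sup>2) \<le> (1/d)\<^sup>2"
    using bI by eventually_elim (rule sq)
  note i2 = integrable_bound[OF _ this]
  have i: "integrable M (\<lambda>t. (Re (cauchy_kernel z t))\<^sup>2)" "integrable M (\<lambda>t. (Im (cauchy_kernel z t))\<^sup>2)"
    by (rule i1 i2; measurable)+
  note G = kernel_integrable[OF assms] and tG = t_kernel[OF assms]
  have 1: "Re (cauchy_transform M z) = (\<integral>t. Re (cauchy_kernel z t) \<partial>M)" "Im (cauchy_transform M z) = (\<integral>t. Im (cauchy_kernel z t) \<partial>M)"
    using G by (simp_all add: cauchy_transform_kernel)
  have 2: "Re (z * cauchy_transform M z - 1) = (\<integral>t. t * Re (cauchy_kernel z t) \<partial>M)"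
     "Im (z * cauchy_transform M z - 1) = (\<integral>t. t * Im (cauchy_kernel z t) \<partial>M)"
    unfolding tG(2)[symmetric] using integral_Re[OF tG(1)] integral_Im[OF tG(1)] by simp_all
  have "(\<integral>t. (cmod (cauchy_kernel z t))\<^sup>2 \<partial>M) = (\<integral>t. (Re (cauchy_kernel z t))\<^sup>2 \<partial>M) + (\<integral>t. (Im (cauchy_kernel z t))\<^sup>2 \<partial>M)"
    using i by (simp add: cmod_power2)
  then show ?thesis
    using bessel[OF _ bR] bessel[OF _ bI] unfolding cmod_power2[of "cauchy_transform M z"]
      cmod_power2[of "z * cauchy_transform M z - 1"] 1 2 by simp
qed

text \<open>At a zero, the formula for the imaginary part makes the integral of the squared kernel
  vanish, while Bessel's inequality bounds it below by |0 - 1|^2 = 1.\<close>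

lemma cauchy_transform_nonzero:
  assumes "Im z > 0" shows "cauchy_transform M z \<noteq> 0"
proof
  assume 0: "cauchy_transform M z = 0"
  have "Im z * (\<integral>t. (cmod (cauchy_kernel z t))\<^sup>2 \<partial>M) = 0"
    using Im_cauchy_transform[of z] 0 assms by (auto simp: off_measureI_Im)
  then show False
    using bessel_kernel[of z] assms 0 by (auto simp: off_measureI_Im)
qed

text \<open>Here K = (z G - 1) / G, and Im (1 / G) is Im z times the integral of the squared kernel,
  divided by |G|^2. Bessel's inequality thus becomes Im F >= Im z (1 + |K|^2).\<close>

lemma Im_K_transform:
  assumes "Im z > 0"
  shows "Im z * (cmod (K_transform M z))\<^sup>2 \<le> - Im (K_transform M z)"
proof -
  let ?G = "cauchy_transform M z" and ?K = "K_transform M z" and ?y = "Im z"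
  have off: "off_measure M z" using assms by (simp add: off_measureI_Im)
  have G: "?G \<noteq> 0" by (rule cauchy_transform_nonzero[OF assms])
  then have G2: "(cmod ?G)\<^sup>2 > 0" by simp
  have KG: "?K = (z * ?G - 1) / ?G" using G by (simp add: K_transform_def F_transform_def field_simps)
  have "Im (1 / ?G) = - Im ?G / (cmod ?G)\<^sup>2" by (simp add: Im_divide cmod_power2)
  also have "\<dots> = ?y * (\<integral>t. (cmod (cauchy_kernel z t))\<^sup>2 \<partial>M) / (cmod ?G)\<^sup>2"
    by (simp add: Im_cauchy_transform[OF off])
  also have "\<dots> \<ge> ?y * ((cmod ?G)\<^sup>2 + (cmod (z * ?G - 1))\<^sup>2) / (cmod ?G)\<^sup>2"
    by (intro divide_right_mono mult_left_mono bessel_kernel off) (use assms in auto)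
  finally have "?y * ((cmod ?G)\<^sup>2 + (cmod (z * ?G - 1))\<^sup>2) / (cmod ?G)\<^sup>2 \<le> Im (1 / ?G)" .
  moreover have "?y * ((cmod ?G)\<^sup>2 + (cmod (z * ?G - 1))\<^sup>2) / (cmod ?G)\<^sup>2 = ?y + ?y * (cmod ?K)\<^sup>2"
    unfolding KG norm_divide power_divide using G2 by (simp add: field_simps)
  ultimately show ?thesis by (simp add: K_transform_def F_transform_def)
qed

lemma Im_K_transform_nonpos: "Im z > 0 \<Longrightarrow> Im (K_transform M z) \<le> 0"
  using Im_K_transform[of z] by (smt (verit) mult_nonneg_nonneg zero_le_power2)

lemma norm_K_transform_le:
  assumes "Im z > 0" shows "cmod (K_transform M z) \<le> 1 / Im z"
proof (cases "K_transform M z = 0")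
  case False
  have "Im z * (cmod (K_transform M z))\<^sup>2 \<le> cmod (K_transform M z)"
    using Im_K_transform[OF assms] abs_Im_le_cmod[of "K_transform M z"] by linarith
  then have "Im z * cmod (K_transform M z) \<le> 1"
    using False by (simp add: power2_eq_square mult.assoc[symmetric])
  then show ?thesis using assms by (simp add: field_simps)
qed (use assms in simp)

lemma K_transform_holomorphic: "K_transform M holomorphic_on {z. Im z > 0}"
  unfolding K_transform_def[abs_def] F_transform_def[abs_def]
  by (intro holomorphic_intros cauchy_transform_holomorphic) (simp add: cauchy_transform_nonzero)

end

section \<open>Cauchy's formula on a half plane\<close>

lemma integrable_inverse_1_plus_square': "integrable lborel (\<lambda>x::real. inverse (1 + x\<^sup>2))"
  using integrable_inverse_1_plus_square by (simp add: set_integrable_def power2_eq_square)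

lemma integrable_inverse_square_decay:
  fixes f :: "real \<Rightarrow> complex"
  assumes cont: "continuous_on UNIV f" and T: "T > 0" 
    and bound: "\<And>x. \<bar>x\<bar> \<ge> T \<Longrightarrow> cmod (f x) \<le> C / x\<^sup>2"
  shows "integrable lborel f"
proof -
  have "compact (f ` {-T..T})"
    by (intro compact_continuous_image continuous_on_subset[OF cont]) auto
  then obtain B where B: "\<And>x. x \<in> {-T..T} \<Longrightarrow> cmod (f x) \<le> B"
    by (metis (no_types, lifting) compact_imp_bounded bounded_iff imageI)
  have B0: "B \<ge> 0" using B[of 0] T norm_ge_zero[of "f 0"] by (meson atLeastAtMost_iff neg_le_0_iff_le less_imp_le order.trans)
  have C0: "C \<ge> 0"
  proof -
    have "0 \<le> C / T\<^sup>2" using bound[of T] T norm_ge_zero[of "f T"] by linarith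
    then show ?thesis using T by (simp add: zero_le_divide_iff)
  qed
  \<comment> \<open>\<open>D\<close> serves both regions: B (1 + T^2) handles [-T, T], and C (1 + 1
    / T^2) handles the rest, where (1 + x^2) / x^2 is largest at |x| = T.\<close>
  define D where "D = B * (1 + T\<^sup>2) + C * (1 + 1 / T\<^sup>2)"
  have "integrable lborel (\<lambda>x. D * inverse (1 + x\<^sup>2))"
    by (intro integrable_mult_right integrable_inverse_1_plus_square')
  then show ?thesis
  proof (rule Bochner_Integration.integrable_bound)
    show "f \<in> borel_measurable lborel" using borel_measurable_continuous_onI[OF cont] by simp
    show "AE x in lborel. norm (f x) \<le> norm (D * inverse (1 + x\<^sup>2))"
    proof (rule AE_I2)
      fix x :: real
      have "norm (f x) * (1 + x\<^sup>2) \<le> D"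
      proof (cases "\<bar>x\<bar> \<ge> T")
        case True
        then have x: "T\<^sup>2 \<le> x\<^sup>2" "x\<^sup>2 > 0" using T by (auto simp: abs_le_square_iff[symmetric])
        have "norm (f x) * (1 + x\<^sup>2) \<le> C / x\<^sup>2 * (1 + x\<^sup>2)"
          using bound[OF True] by (intro mult_right_mono) auto
        also have "\<dots> = C * (1 + 1 / x\<^sup>2)" using x by (simp add: field_simps)
        also have "\<dots> \<le> C * (1 + 1 / T\<^sup>2)"
          using x T C0 by (intro mult_left_mono add_left_mono frac_le) auto
        also have "\<dots> \<le> D" using B0 by (simp add: D_def)
        finally show ?thesis .
      next
        case False
        then have "norm (f x) \<le> B" by (intro B) auto
        moreover have "x\<^sup>2 \<le> T\<^sup>2" using False T by (simp add: abs_le_square_iff[symmetric])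
        ultimately have "norm (f x) * (1 + x\<^sup>2) \<le> B * (1 + T\<^sup>2)"
          using B0 by (intro mult_mono) auto
        also have "\<dots> \<le> D" using C0 by (simp add: D_def)
        finally show ?thesis .
      qed
      then have "norm (f x) \<le> D * inverse (1 + x\<^sup>2)"
        by (simp add: field_simps add_pos_nonneg)
      then show "norm (f x) \<le> norm (D * inverse (1 + x\<^sup>2))" by simp
    qed
  qed
qed

text \<open>The segment [-T, T] is closed up to a rectangle. The other three sides have total length
  4 T and carry |\<open>\<phi>\<close>| <= C / T^2, so they contribute at most 4 C / T. Continuity
  is asked only on the real line and far out, which leaves room for a pole inside.\<close>

lemma line_integral_eq_rectangle_limit:
  fixes \<phi> :: "complex \<Rightarrow> complex"
  assumes cont: "continuous_on ({z. Im z = 0} \<union> {z. Im z \<ge> 0 \<and> cmod z \<ge> T0}) \<phi>"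
    and bound: "\<And>z. Im z \<ge> 0 \<Longrightarrow> cmod z \<ge> T0 \<Longrightarrow> cmod (\<phi> z) \<le> C / (cmod z)\<^sup>2"
    and T0: "T0 > 0"
    and c: "\<And>T. T \<ge> T0 \<Longrightarrow> contour_integral (rectpath (of_real (-T)) (Complex T T)) \<phi> = c"
  shows "integrable lborel (\<lambda>x. \<phi> (of_real x))" and "(LBINT x. \<phi> (of_real x)) = c"
proof -
  have contR: "continuous_on UNIV (\<lambda>x. \<phi> (of_real x))"
    by (rule continuous_on_compose2[OF cont]) (auto intro!: continuous_intros)
  show int: "integrable lborel (\<lambda>x. \<phi> (of_real x))"
    by (rule integrable_inverse_square_decay[OF contR T0, of C]) (use bound[of "of_real _"] in auto)
  have C0: "C \<ge> 0"
  proof -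
    have "cmod (\<phi> T0) \<le> C / T0\<^sup>2" using bound[of "of_real T0"] T0 by simp
    then have "0 \<le> C / T0\<^sup>2" by (rule order.trans[OF norm_ge_zero])
    then show ?thesis using T0 by (simp add: zero_le_divide_iff)
  qed
  have est: "cmod ((LBINT x:{-T..T}. \<phi> (of_real x)) - c) \<le> 4 * C / T" if T: "T \<ge> T0" for T
  proof -
    let ?a = "complex_of_real (-T)" and ?b = "complex_of_real T"
      and ?d = "Complex T T" and ?e = "Complex (-T) T"
    have Tp: "T > 0" using T T0 by simp
    have seg: "cmod z \<ge> T \<and> Im z \<ge> 0"
      if "z \<in> closed_segment ?b ?d \<union> closed_segment ?d ?e \<union> closed_segment ?e ?a" for z
    proof -
      have "(\<bar>Re z\<bar> = T \<or> Im z = T) \<and> Im z \<ge> 0"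
        using that Tp by (auto simp: closed_segment_same_Re closed_segment_same_Im closed_segment_eq_real_ivl)
      then show ?thesis using abs_Re_le_cmod[of z] abs_Im_le_cmod[of z] by auto
    qed
    have bd: "cmod (\<phi> z) \<le> C / T\<^sup>2"
      if "z \<in> closed_segment ?b ?d \<union> closed_segment ?d ?e \<union> closed_segment ?e ?a" for z
    proof -
      have "cmod (\<phi> z) \<le> C / (cmod z)\<^sup>2" using bound[of z] seg[OF that] T by auto
      also have "\<dots> \<le> C / T\<^sup>2" using seg[OF that] Tp C0 by (intro frac_le power_mono) auto
      finally show ?thesis .
    qed
    have ci: "\<phi> contour_integrable_on linepath ?b ?d" "\<phi> contour_integrable_on linepath ?d ?e"
       "\<phi> contour_integrable_on linepath ?e ?a" "\<phi> contour_integrable_on linepath ?a ?b"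
    proof -
      let ?D = "{z. Im z = 0} \<union> {z. Im z \<ge> 0 \<and> cmod z \<ge> T0}"
      have 1: "closed_segment ?b ?d \<union> closed_segment ?d ?e \<union> closed_segment ?e ?a \<subseteq> ?D"
      proof
        fix z assume "z \<in> closed_segment ?b ?d \<union> closed_segment ?d ?e \<union> closed_segment ?e ?a"
        from seg[OF this] T show "z \<in> ?D" by simp
      qed
      have 2: "closed_segment ?a ?b \<subseteq> ?D"
        by (auto simp: closed_segment_same_Im)
      show "\<phi> contour_integrable_on linepath ?b ?d" "\<phi> contour_integrable_on linepath ?d ?e"
       "\<phi> contour_integrable_on linepath ?e ?a" "\<phi> contour_integrable_on linepath ?a ?b"
        by (rule contour_integrable_continuous_linepath, rule continuous_on_subset[OF cont], use 1 2 in simp)+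
    qed
    have cp: "0 \<le> C / T\<^sup>2" using C0 by simp
    have "c = contour_integral (linepath ?a ?b) \<phi> + (contour_integral (linepath ?b ?d) \<phi> +
        (contour_integral (linepath ?d ?e) \<phi> + contour_integral (linepath ?e ?a) \<phi>))"
    proof -
      have eqs: "Complex (Re ?d) (Im ?a) = ?b" "Complex (Re ?a) (Im ?d) = ?e"
        by (simp_all add: complex_eq_iff)
      show ?thesis
        unfolding c[OF T, symmetric] rectpath_def Let_def eqs
        using ci by (simp add: contour_integral_join contour_integrable_joinI valid_path_join)
    qed
    moreover have "contour_integral (linepath ?a ?b) \<phi> = (LBINT x:{-T..T}. \<phi> (of_real x))"
    proof -
      have "set_integrable lborel {-T..T} (\<lambda>x. \<phi> (of_real x))"
        unfolding set_integrable_def by (rule integrable_mult_indicator) (use int in auto)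
      then show ?thesis using Tp
        by (subst contour_integral_linepath_Reals_eq) (auto simp: set_borel_integral_eq_integral)
    qed
    moreover have "cmod (contour_integral (linepath ?b ?d) \<phi>) \<le> C / T\<^sup>2 * cmod (?d - ?b)"
      by (intro contour_integral_bound_linepath ci cp bd) auto
    moreover have "cmod (?d - ?b) = T" using Tp by (simp add: cmod_def)
    moreover have "cmod (contour_integral (linepath ?d ?e) \<phi>) \<le> C / T\<^sup>2 * cmod (?e - ?d)"
      by (intro contour_integral_bound_linepath ci cp bd) auto
    moreover have "cmod (?e - ?d) = 2 * T" using Tp by (simp add: cmod_def real_sqrt_mult)
    moreover have "cmod (contour_integral (linepath ?e ?a) \<phi>) \<le> C / T\<^sup>2 * cmod (?a - ?e)"
      by (intro contour_integral_bound_linepath ci cp bd) auto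
    moreover have "cmod (?a - ?e) = T" using Tp by (simp add: cmod_def)
    ultimately have "cmod ((LBINT x:{-T..T}. \<phi> (of_real x)) - c) \<le> C / T\<^sup>2 * T + (C / T\<^sup>2 * (2 * T) + C / T\<^sup>2 * T)"
      by (smt (verit, ccfv_SIG) add_diff_cancel_left' norm_minus_commute norm_triangle_mono)
    also have "\<dots> = 4 * C / T" using Tp by (simp add: field_simps power2_eq_square)
    finally show ?thesis .
  qed
  have "(\<lambda>n. LBINT x:{- real n..real n}. \<phi> (of_real x)) \<longlonglongrightarrow> (LBINT x. \<phi> (of_real x))"
    unfolding set_lebesgue_integral_def
  proof (rule integral_dominated_convergence[where w = "\<lambda>x. cmod (\<phi> (of_real x))"])
    show "AE x in lborel. (\<lambda>n. indicator {- real n..real n} x *\<^sub>R \<phi> (of_real x)) \<longlonglongrightarrow> \<phi> (of_real x)"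
    proof (rule AE_I2, rule tendsto_eventually)
      fix x :: real
      obtain n where n: "\<bar>x\<bar> \<le> real n" using real_arch_simple by blast
      show "\<forall>\<^sub>F n in sequentially. indicator {- real n..real n} x *\<^sub>R \<phi> (of_real x) = \<phi> (of_real x)"
        using eventually_ge_at_top[of n]
      proof eventually_elim
        case (elim k)
        then have "\<bar>x\<bar> \<le> real k" using n by simp
        then show ?case by (simp add: abs_le_iff indicator_def)
      qed
    qed
    show "AE x in lborel. norm (indicator {- real n..real n} x *\<^sub>R \<phi> (of_real x)) \<le> cmod (\<phi> (of_real x))" for n
      by (auto split: split_indicator)
  qed (use int borel_measurable_continuous_onI[OF contR] in auto)
  moreover have "(\<lambda>n. LBINT x:{- real n..real n}. \<phi> (of_real x)) \<longlonglongrightarrow> c"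
  proof (rule LIM_zero_cancel, rule Lim_null_comparison)
    obtain N where N: "T0 \<le> real N" using real_arch_simple by blast
    show "\<forall>\<^sub>F n in sequentially. norm ((LBINT x:{- real n..real n}. \<phi> (of_real x)) - c) \<le> 4 * C / real n"
      using eventually_ge_at_top[of N] by eventually_elim (rule est, use N in auto)
    show "(\<lambda>n. 4 * C / real n) \<longlonglongrightarrow> 0" by real_asymp
  qed
  ultimately show "(LBINT x. \<phi> (of_real x)) = c" by (rule LIMSEQ_unique)
qed

section \<open>Functions normalised like 1 / z as Cauchy transforms of probability measures\<close>

lemma norm_add_ii_ge: "Im z \<ge> 0 \<Longrightarrow> y \<ge> 0 \<Longrightarrow> cmod z \<le> cmod (z + \<i> * of_real y)"
  by (auto simp: cmod_def intro!: real_sqrt_le_mono power_mono)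

text \<open>\<open>decay\<close> is a quantitative form of z g(z) -> 1 along the imaginary axis,
  which gives the representing measure total mass 1; the constant \<open>c\<close> also controls the
  tails of the approximating measures.\<close>

locale nevanlinna_normalized =
  fixes g :: "complex \<Rightarrow> complex" and c :: real
  assumes holo: "g holomorphic_on {z. Im z > 0}"
    and Im_le: "\<And>z. Im z > 0 \<Longrightarrow> Im (g z) \<le> 0"
    and decay: "\<And>z. Im z > 0 \<Longrightarrow> cmod (z * g z - 1) \<le> c / (Im z)\<^sup>2"
begin

lemma c_nonneg: "c \<ge> 0"
  using order.trans[OF norm_ge_zero decay[of \<i>]] by simp

text \<open>At height at least y, \<open>decay\<close> bounds |w g(w)| by 1 + c / y^2; the upward
  shift thus gives decay of order 1 / |z| down to the real line.\<close>

lemma norm_le_shift: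
  assumes y: "y > 0" and z: "Im z \<ge> 0" "z \<noteq> 0"
  shows "cmod (g (z + \<i> * of_real y)) \<le> (1 + c / y\<^sup>2) / cmod z"
proof -
  let ?w = "z + \<i> * of_real y"
  have w: "Im ?w \<ge> y" "Im ?w > 0" using y z by auto
  have "cmod (?w * g ?w - 1) \<le> c / (Im ?w)\<^sup>2" by (rule decay[OF w(2)])
  also have "\<dots> \<le> c / y\<^sup>2" using w y c_nonneg by (intro frac_le power_mono) auto
  finally have "cmod (?w * g ?w) \<le> 1 + c / y\<^sup>2"
    using norm_triangle_ineq2[of "?w * g ?w" 1] by simp
  moreover have "cmod z * cmod (g ?w) \<le> cmod (?w * g ?w)"
    unfolding norm_mult using norm_add_ii_ge[of z y] y z by (intro mult_right_mono) auto
  ultimately show ?thesis using z by (simp add: field_simps)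
qed

lemma shift_holomorphic: "y > 0 \<Longrightarrow> (\<lambda>z. g (z + \<i> * of_real y)) holomorphic_on {z. Im z > - y}"
proof -
  assume "y > 0"
  then have "(\<lambda>z. z + \<i> * of_real y) ` {z. Im z > - y} \<subseteq> {z. Im z > 0}" by auto
  from holomorphic_on_compose_gen[OF _ holo this]
  show ?thesis unfolding o_def by (simp add: holomorphic_intros)
qed

lemma shift_continuous: "y > 0 \<Longrightarrow> continuous_on {z. Im z \<ge> 0} (\<lambda>z. g (z + \<i> * of_real y))"
  by (rule continuous_on_subset[OF holomorphic_on_imp_continuous_on[OF shift_holomorphic]]) auto

text \<open>The integrand is O(1 / |z|^2), one factor coming from \<open>norm_le_shift\<close> and
  one from z - w, so large rectangles compute the line integral. The pole contributes for w above
  the line and lies outside the rectangle for w below it.\<close>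

lemma cauchy_half_plane:
  assumes y: "y > 0" and w: "Im w \<noteq> 0"
  defines "\<phi> \<equiv> \<lambda>z. g (z + \<i> * of_real y) / (z - w)"
  shows "integrable lborel (\<lambda>x. \<phi> (of_real x))"
    and "(LBINT x. \<phi> (of_real x)) = (if Im w > 0 then 2 * pi * \<i> * g (w + \<i> * of_real y) else 0)"
proof -
  \<comment> \<open>Beyond this radius |z - w| >= |z| / 2, which explains the factor 2 in
    \<open>C\<close>; it also keeps \<open>w\<close> off the three outer sides.\<close>
  define T0 where "T0 = 2 * cmod w + 1"
  define C where "C = 2 * (1 + c / y\<^sup>2)"
  define e where "e = (if Im w > 0 then 2 * pi * \<i> * g (w + \<i> * of_real y) else 0)"
  have T0: "T0 > 0" by (simp add: T0_def add_nonneg_pos)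
  have "continuous_on ({z. Im z = 0} \<union> {z. Im z \<ge> 0 \<and> cmod z \<ge> T0}) \<phi>"
    unfolding \<phi>_def
    by (intro continuous_intros continuous_on_subset[OF shift_continuous[OF y]]) (use w norm_ge_zero[of w] in \<open>auto simp: T0_def simp del: norm_ge_zero\<close>)
  moreover have "cmod (\<phi> z) \<le> C / (cmod z)\<^sup>2" if z: "Im z \<ge> 0" "cmod z \<ge> T0" for z
  proof -
    have z0: "cmod z > 0" using z T0 by auto
    have "cmod z / 2 \<le> cmod (z - w)"
      using z(2) norm_triangle_ineq2[of z w] by (simp add: T0_def)
    then have "cmod (\<phi> z) \<le> ((1 + c / y\<^sup>2) / cmod z) / (cmod z / 2)"
      unfolding \<phi>_def norm_divide using z0 z c_nonneg by (intro frac_le norm_le_shift[OF y]) auto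
    then show ?thesis using z0 by (simp add: C_def power2_eq_square field_simps)
  qed
  moreover have "contour_integral (rectpath (of_real (-T)) (Complex T T)) \<phi> = e" if T: "T \<ge> T0" for T
  proof (rule contour_integral_unique)
    let ?p = "rectpath (of_real (-T)) (Complex T T)"
    have Tp: "T > 0" using T T0 by simp
    have img: "path_image ?p = {z. Re z \<in> {-T, T} \<and> Im z \<in> {0..T}} \<union> {z. Im z \<in> {0, T} \<and> Re z \<in> {-T..T}}"
      using Tp by (subst path_image_rectpath) auto
    have wT: "\<bar>Re w\<bar> < T" "\<bar>Im w\<bar> < T"
      using T abs_Re_le_cmod[of w] abs_Im_le_cmod[of w] by (auto simp: T0_def)
    have conv: "convex {z. Im z > a}" for a by (rule convex_halfspace_Im_gt)
    show "(\<phi> has_contour_integral e) ?p"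
    proof (cases "Im w > 0")
      case True
      have "w \<in> box (of_real (-T)) (Complex T T)"
        using True wT by (auto simp: in_box_complex_iff)
      then have wn: "winding_number ?p w = 1" by (rule winding_number_rectpath)
      have "(\<phi> has_contour_integral (2*pi * \<i> * winding_number ?p w * g (w + \<i> * of_real y))) ?p"
        unfolding \<phi>_def
      proof (rule Cauchy_integral_formula_convex_simple[OF conv shift_holomorphic[OF y]])
        show "w \<in> interior {z. Im z > - y}"
          using True y by (subst interior_open) (auto intro: open_halfspace_Im_gt)
        show "path_image ?p \<subseteq> {z. - y < Im z} - {w}"
          unfolding img using y True wT by auto
      qed auto
      then show ?thesis using True wn by (simp add: e_def)
    next
      case False
      have "(\<phi> has_contour_integral 0) ?p"
      \<comment> \<open>The half plane above max (-y) (Im w) is convex, contains the rectangle,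
        excludes the pole and lies inside the domain of the shifted function.\<close>
      proof (rule Cauchy_theorem_convex_simple[OF _ conv[of "max (-y) (Im w)"]])
        show "\<phi> holomorphic_on {z. max (- y) (Im w) < Im z}"
          unfolding \<phi>_def
          by (intro holomorphic_intros holomorphic_on_subset[OF shift_holomorphic[OF y]]) auto
        show "path_image ?p \<subseteq> {z. max (- y) (Im w) < Im z}"
          unfolding img using y False w Tp by auto
      qed auto
      then show ?thesis using False by (simp add: e_def)
    qed
  qed
  ultimately show "integrable lborel (\<lambda>x. \<phi> (of_real x))" "(LBINT x. \<phi> (of_real x)) = e"
    using line_integral_eq_rectangle_limit[of T0 \<phi> C e] T0 by blast+
qed

definition boundary_density :: "real \<Rightarrow> real \<Rightarrow> real" where
  "boundary_density y x = - Im (g (of_real x + \<i> * of_real y)) / pi"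

lemma boundary_density_nonneg: "y > 0 \<Longrightarrow> boundary_density y x \<ge> 0"
  using Im_le[of "of_real x + \<i> * of_real y"] by (simp add: boundary_density_def divide_le_0_iff)

lemma boundary_density_measurable [measurable]: "y > 0 \<Longrightarrow> boundary_density y \<in> borel_measurable borel"
  unfolding boundary_density_def
  by (intro borel_measurable_continuous_onI continuous_intros
      continuous_on_compose2[OF shift_continuous, of y UNIV of_real]) auto

text \<open>Cauchy's formula is used at w, with value 2 pi i g, and at cnj w, with value 0.
  Conjugating the second and subtracting replaces g by cnj g - g = -2 i Im g, which is the density
  up to a factor.\<close>

lemma boundary_density_cauchy:
  assumes y: "y > 0" and w: "Im w > 0"
  shows "integrable lborel (\<lambda>x. of_real (boundary_density y x) * cauchy_kernel w x)"
    and "(LBINT x. of_real (boundary_density y x) * cauchy_kernel w x) = g (w + \<i> * of_real y)"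
proof -
  define f where "f = (\<lambda>x::real. g (of_real x + \<i> * of_real y))"
  have 1: "integrable lborel (\<lambda>x. f x / (of_real x - w))"
          "(LBINT x. f x / (of_real x - w)) = 2 * pi * \<i> * g (w + \<i> * of_real y)"
    using cauchy_half_plane[OF y, of w] w by (auto simp: f_def)
  have "integrable lborel (\<lambda>x. f x / (of_real x - cnj w))" "(LBINT x. f x / (of_real x - cnj w)) = 0"
    using cauchy_half_plane[OF y, of "cnj w"] w by (auto simp: f_def)
  then have 2: "integrable lborel (\<lambda>x. cnj (f x) / (of_real x - w))"
          "(LBINT x. cnj (f x) / (of_real x - w)) = 0"
    using Bochner_Integration.integral_cnj[of lborel "\<lambda>x. f x / (of_real x - cnj w)"]
      Bochner_Integration.integrable_cnj[of lborel "\<lambda>x. f x / (of_real x - cnj w)"] by simp_all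
  have eq: "of_real (boundary_density y x) * cauchy_kernel w x = \<i> / (2 * pi) * (cnj (f x) / (of_real x - w) - f x / (of_real x - w))" 
    (is "?l = ?r") for x
  proof -
    have "cnj (f x) - f x = - 2 * \<i> * of_real (Im (f x))" by (simp add: complex_eq_iff)
    moreover have "?r = \<i> / (2 * pi) * ((cnj (f x) - f x) / (of_real x - w))"
      by (simp add: diff_divide_distrib)
    ultimately have "?r = \<i> / (2 * pi) * ((- 2 * \<i> * of_real (Im (f x))) / (of_real x - w))" by simp
    also have "\<dots> = of_real (Im (f x)) / pi / (of_real x - w)" by simp
    also have "\<dots> = of_real (Im (f x)) / pi / (- (w - of_real x))" by simp
    also have "\<dots> = ?l"
      unfolding divide_minus_right boundary_density_def f_def cauchy_kernel_def by simp
    finally show ?thesis by (rule sym)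
  qed
  show "integrable lborel (\<lambda>x. of_real (boundary_density y x) * cauchy_kernel w x)"
    unfolding eq using 1 2 by simp
  show "(LBINT x. of_real (boundary_density y x) * cauchy_kernel w x) = g (w + \<i> * of_real y)"
    unfolding eq using 1 2 by simp
qed

text \<open>At \<open>w = \<i> v\<close> the imaginary part of the Cauchy formula is a Poisson integral.\<close>
lemma boundary_density_poisson:
  assumes y: "y > 0" and v: "v > 0"
  shows "(\<integral>\<^sup>+x. ennreal (boundary_density y x * (v\<^sup>2 / (v\<^sup>2 + x\<^sup>2))) \<partial>lborel) = ennreal (- v * Im (g (\<i> * of_real (v + y))))"
proof -
  have v': "Im (\<i> * of_real v) > 0" using v by simp
  note * = boundary_density_cauchy[OF y v']
  have eq: "Im (of_real (boundary_density y x) * cauchy_kernel (\<i> * of_real v) x) = - (boundary_density y x * (v / (v\<^sup>2 + x\<^sup>2)))" for x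
    by (simp add: cauchy_kernel_def Im_divide power2_eq_square add.commute)
  have "integrable lborel (\<lambda>x. Im (of_real (boundary_density y x) * cauchy_kernel (\<i> * of_real v) x))"
    using *(1) by (rule integrable_Im)
  then have i: "integrable lborel (\<lambda>x. boundary_density y x * (v / (v\<^sup>2 + x\<^sup>2)))"
    unfolding eq by simp
  have "(LBINT x. boundary_density y x * (v / (v\<^sup>2 + x\<^sup>2))) = - Im (g (\<i> * of_real (v + y)))"
    using integral_Im[OF *(1)] *(2) unfolding eq by (simp add: algebra_simps)
  then have "(LBINT x. v * (boundary_density y x * (v / (v\<^sup>2 + x\<^sup>2)))) = - v * Im (g (\<i> * of_real (v + y)))"
    by (subst integral_mult_right_zero) (simp only: mult_minus_left mult_minus_right)
  moreover have eq2: "v * (boundary_density y x * (v / (v\<^sup>2 + x\<^sup>2))) = boundary_density y x * (v\<^sup>2 / (v\<^sup>2 + x\<^sup>2))" for x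
    by (simp add: power2_eq_square)
  moreover have "integrable lborel (\<lambda>x. boundary_density y x * (v\<^sup>2 / (v\<^sup>2 + x\<^sup>2)))"
    using integrable_mult_right[OF i, of v] unfolding eq2 by simp
  ultimately show ?thesis
    using boundary_density_nonneg[OF y] by (subst nn_integral_eq_integral) (simp_all only: AE_I2 mult_nonneg_nonneg divide_nonneg_nonneg zero_le_power2 add_nonneg_nonneg)
qed

text \<open>With e = z g(z) - 1 at z = i (v + y), the quantity -v Im g equals v (1 + Re e) / (v +
  y), so its distance to 1 splits into a shift error y / v and a decay error c / v^2.\<close>

lemma poisson_limit:
  assumes y: "y \<ge> 0" and v: "v > 0"
  shows "\<bar>- v * Im (g (\<i> * of_real (v + y))) - 1\<bar> \<le> y / v + c / v\<^sup>2"
proof -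
  define z where "z = \<i> * of_real (v + y)"
  define e where "e = z * g z - 1"
  have z: "Im z = v + y" "Im z > 0" using y v by (auto simp: z_def)
  have "Re e = - (v + y) * Im (g z) - 1" by (simp add: e_def z_def algebra_simps)
  then have Ig: "- Im (g z) = (1 + Re e) / (v + y)" using z by (simp add: field_simps)
  have "\<bar>Re e\<bar> \<le> c / (v + y)\<^sup>2"
    using decay[OF z(2)] abs_Re_le_cmod[of e] z by (simp add: e_def)
  also have "\<dots> \<le> c / v\<^sup>2" using c_nonneg y v by (intro frac_le power_mono) auto
  finally have e: "\<bar>Re e\<bar> \<le> c / v\<^sup>2" .
  have "- v * Im (g z) - 1 = v * ((1 + Re e) / (v + y)) - 1" unfolding Ig[symmetric] by simp
  also have "\<dots> = v / (v + y) * Re e - y / (v + y)" using z by (simp add: divide_simps) (simp add: algebra_simps)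
  finally have "\<bar>- v * Im (g z) - 1\<bar> \<le> \<bar>v / (v + y) * Re e\<bar> + \<bar>y / (v + y)\<bar>"
    by (simp only: abs_triangle_ineq4)
  also have "\<bar>v / (v + y) * Re e\<bar> \<le> 1 * \<bar>Re e\<bar>"
    unfolding abs_mult using y v by (intro mult_right_mono) auto
  also have "\<bar>y / (v + y)\<bar> \<le> y / v" using y v by (auto intro!: frac_le)
  finally show ?thesis using e by (simp add: z_def)
qed

definition boundary_measure :: "real \<Rightarrow> real measure" where
  "boundary_measure y = density lborel (\<lambda>x. ennreal (boundary_density y x))"

text \<open>The factors v^2 / (v^2 + x^2) increase to 1 with v, so by monotone convergence the total
  mass is the limit of the Poisson integrals, which \<open>poisson_limit\<close> evaluates.\<close>

lemma boundary_density_total: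
  assumes y: "y > 0" shows "(\<integral>\<^sup>+x. ennreal (boundary_density y x) \<partial>lborel) = 1"
proof -
  define k where "k n x = (real (Suc n))\<^sup>2 / ((real (Suc n))\<^sup>2 + x\<^sup>2)" for n :: nat and x :: real
  have pos: "(real (Suc n))\<^sup>2 + x\<^sup>2 > 0" for n x by (simp add: add_pos_nonneg)
  have mono: "k m x \<le> k n x" if "m \<le> n" for m n x
  proof -
    have "(real (Suc m))\<^sup>2 * x\<^sup>2 \<le> (real (Suc n))\<^sup>2 * x\<^sup>2"
      using that by (intro mult_right_mono power_mono) auto
    then show ?thesis
      unfolding k_def using pos[of m x] pos[of n x] by (simp add: divide_simps) (simp add: algebra_simps)
  qed
  have lim: "(\<lambda>n. k n x) \<longlonglongrightarrow> 1" for x unfolding k_def by real_asymp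
  have "(\<lambda>n. \<integral>\<^sup>+x. ennreal (boundary_density y x * k n x) \<partial>lborel) \<longlonglongrightarrow> (\<integral>\<^sup>+x. ennreal (boundary_density y x) \<partial>lborel)"
  proof (rule nn_integral_LIMSEQ)
    show "incseq (\<lambda>n x. ennreal (boundary_density y x * k n x))"
      by (auto simp: incseq_def le_fun_def intro!: ennreal_leI mult_left_mono mono boundary_density_nonneg y)
    show "(\<lambda>n. ennreal (boundary_density y x * k n x)) \<longlonglongrightarrow> ennreal (boundary_density y x)" for x
      using tendsto_mult[OF tendsto_const lim, of "boundary_density y x" x] by (intro tendsto_ennrealI) simp
    show "(\<lambda>x. ennreal (boundary_density y x * k n x)) \<in> borel_measurable lborel" for n
      unfolding k_def using boundary_density_measurable[OF y] by measurable
  qed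
  moreover have "(\<lambda>n. \<integral>\<^sup>+x. ennreal (boundary_density y x * k n x) \<partial>lborel) \<longlonglongrightarrow> ennreal 1"
  proof -
    have "(\<lambda>n. - real (Suc n) * Im (g (\<i> * of_real (real (Suc n) + y)))) \<longlonglongrightarrow> 1"
    proof (rule LIM_zero_cancel, rule Lim_null_comparison)
      show "\<forall>\<^sub>F n in sequentially. norm (- real (Suc n) * Im (g (\<i> * of_real (real (Suc n) + y))) - 1)
          \<le> y / real (Suc n) + c / (real (Suc n))\<^sup>2"
        using poisson_limit[of y "real (Suc _)"] y by (intro always_eventually allI) (simp only: real_norm_def)
      show "(\<lambda>n. y / real (Suc n) + c / (real (Suc n))\<^sup>2) \<longlonglongrightarrow> 0" by real_asymp
    qed
    then show ?thesis
      unfolding k_def using boundary_density_poisson[OF y, of "real (Suc _)"] by (simp only: of_nat_0_less_iff zero_less_Suc) (rule tendsto_ennrealI)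
  qed
  ultimately show ?thesis by (simp add: LIMSEQ_unique)
qed

lemma boundary_measure_distribution: assumes y: "y > 0" shows "real_distribution (boundary_measure y)"
proof -
  have "emeasure (boundary_measure y) (space (boundary_measure y)) = 1"
    using boundary_density_total[OF y] boundary_density_measurable[OF y] by (simp add: boundary_measure_def emeasure_density)
  then interpret prob_space "boundary_measure y" by (rule prob_spaceI)
  show ?thesis by unfold_locales (simp_all add: boundary_measure_def)
qed

lemma boundary_measure_cauchy:
  assumes y: "y > 0" and w: "Im w > 0"
  shows "cauchy_transform (boundary_measure y) w = g (w + \<i> * of_real y)"
proof -
  have "cauchy_transform (boundary_measure y) w = (LBINT x. boundary_density y x *\<^sub>R cauchy_kernel w x)"
    unfolding cauchy_transform_kernel boundary_measure_def using boundary_density_measurable[OF y] boundary_density_nonneg[OF y]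
    by (intro integral_density) auto
  then show ?thesis using boundary_density_cauchy(2)[OF y w] by (simp add: scaleR_conv_of_real)
qed

text \<open>The factor v^2 / (v^2 + x^2) is at most 1 on the interval and at most 1/2 off it, so a
  Poisson integral close to 1 forces the mass into the interval. The bound is uniform over y <= 1,
  which is the source of tightness.\<close>

lemma boundary_measure_tail:
  assumes y: "y > 0" and v: "v > 0"
  shows "measure (boundary_measure y) {-v<..v} \<ge> 1 - 2 * (y / v + c / v\<^sup>2)"
proof -
  interpret real_distribution "boundary_measure y" by (rule boundary_measure_distribution[OF y])
  let ?k = "\<lambda>x. v\<^sup>2 / (v\<^sup>2 + x\<^sup>2)"
  have pos: "v\<^sup>2 + x\<^sup>2 > 0" for x using v by (simp add: add_pos_nonneg)
  have k01: "0 \<le> ?k x" "?k x \<le> 1" for x using pos[of x] by auto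
  have ik: "integrable (boundary_measure y) ?k"
    by (rule integrable_const_bound[where B = 1]) (use k01 in auto)
  have "(\<integral>\<^sup>+x. ennreal (?k x) \<partial>boundary_measure y) = (\<integral>\<^sup>+x. ennreal (boundary_density y x) * ennreal (?k x) \<partial>lborel)"
    unfolding boundary_measure_def using boundary_density_measurable[OF y] by (subst nn_integral_density) auto
  also have "\<dots> = (\<integral>\<^sup>+x. ennreal (boundary_density y x * ?k x) \<partial>lborel)"
    by (simp only: ennreal_mult boundary_density_nonneg[OF y] k01)
  finally have "(\<integral>\<^sup>+x. ennreal (?k x) \<partial>boundary_measure y) = ennreal (- v * Im (g (\<i> * of_real (v + y))))"
    unfolding boundary_density_poisson[OF y v] .
  moreover have "- v * Im (g (\<i> * of_real (v + y))) \<ge> 0"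
    using Im_le[of "\<i> * of_real (v + y)"] v y by (simp add: mult_le_0_iff)
  ultimately have "(\<integral>x. ?k x \<partial>boundary_measure y) = - v * Im (g (\<i> * of_real (v + y)))"
    using k01 by (intro integral_eq_nn_integral[THEN trans]) auto
  then have ge: "(\<integral>x. ?k x \<partial>boundary_measure y) \<ge> 1 - (y / v + c / v\<^sup>2)"
    using poisson_limit[of y v] y v by linarith
  have "(\<integral>x. ?k x \<partial>boundary_measure y) \<le> (\<integral>x. 1/2 + 1/2 * indicator {-v<..v} x \<partial>boundary_measure y)"
  proof (intro integral_mono_AE ik AE_I2)
    show "?k x \<le> 1/2 + 1/2 * indicator {-v<..v} x" for x
    proof (cases "x \<in> {-v<..v}")
      case False
      then have "v \<le> \<bar>x\<bar>" by auto
      then have "v\<^sup>2 \<le> x\<^sup>2" using v by (simp add: abs_le_square_iff[symmetric])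
      then have "?k x \<le> 1/2" using pos[of x] by (simp add: field_simps)
      then show ?thesis using False by simp
    qed (use k01[of x] in simp)
    show "integrable (boundary_measure y) (\<lambda>x. 1/2 + 1/2 * indicator {-v<..v} x :: real)"
      by (rule integrable_const_bound[where B = 1]) (auto simp: indicator_def)
  qed
  also have "\<dots> = 1/2 + 1/2 * measure (boundary_measure y) {-v<..v}"
  proof -
    have "integrable (boundary_measure y) (\<lambda>x. 1/2 * indicator {-v<..v} x :: real)"
      by (rule integrable_const_bound[where B = 1]) (auto simp: indicator_def)
    then show ?thesis using prob_space by simp
  qed
  finally show ?thesis using ge by simp
qed

theorem herglotz_representation:
  "\<exists>R. borel_prob R \<and> (\<forall>z. Im z > 0 \<longrightarrow> cauchy_transform R z = g z)"
proof -
  define y where "y n = 1 / real (Suc n)" for n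
  have y: "y n > 0" "y n \<le> 1" for n by (auto simp: y_def)
  have "tight (\<lambda>n. boundary_measure (y n))"
    unfolding tight_def
  proof (intro conjI allI impI)
    fix \<epsilon> :: real assume e: "\<epsilon> > 0"
    have "((\<lambda>v. 2 * (1 / v + c / v\<^sup>2)) \<longlongrightarrow> 0) at_top" by real_asymp
    then have "\<forall>\<^sub>F v in at_top. 2 * (1 / v + c / v\<^sup>2) < \<epsilon>"
      using e by (intro order_tendstoD)
    then obtain v where v: "2 * (1 / v + c / v\<^sup>2) < \<epsilon>" "v > 0"
      using eventually_conj[OF _ eventually_gt_at_top[of 0]] eventually_at_top_linorder by (metis (mono_tags, lifting) order_refl)
    have "measure (boundary_measure (y n)) {-v<..v} > 1 - \<epsilon>" for n
    proof -
      have "y n / v \<le> 1 / v" using y[of n] v by (simp add: divide_right_mono)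
      then show ?thesis using boundary_measure_tail[OF y(1)[of n] v(2)] v(1) by argo
    qed
    then show "\<exists>a b. a < b \<and> (\<forall>n. 1 - \<epsilon> < measure (boundary_measure (y n)) {a<..b})"
      using v(2) by (intro exI[of _ "-v"] exI[of _ v]) auto
  qed (use boundary_measure_distribution y in auto)
  \<comment> \<open>Helly's theorem in its sub-subsequence form, with \<open>id\<close> as the outer
    subsequence.\<close>
  then obtain r R where r: "strict_mono (r :: nat \<Rightarrow> nat)" and R: "real_distribution R"
     and wc: "weak_conv_m ((\<lambda>n. boundary_measure (y n)) \<circ> id \<circ> r) R"
    using tight_imp_convergent_subsubsequence[of "\<lambda>n. boundary_measure (y n)" id] strict_mono_id by blast
  interpret R: real_distribution R by (rule R)
  have "cauchy_transform R z = g z" if z: "Im z > 0" for z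
  proof -
    have "(\<lambda>n. integral\<^sup>L (((\<lambda>n. boundary_measure (y n)) \<circ> id \<circ> r) n) (cauchy_kernel z)) \<longlonglongrightarrow> integral\<^sup>L R (cauchy_kernel z)"
    proof (rule weak_conv_imp_integral_bdd_continuous_conv[OF _ R wc])
      show "real_distribution (((\<lambda>n. boundary_measure (y n)) \<circ> id \<circ> r) n)" for n
        using boundary_measure_distribution y by simp
      show "isCont (cauchy_kernel z) x" for x
        unfolding cauchy_kernel_def using z by (intro continuous_intros) (auto simp: complex_eq_iff)
      show "norm (cauchy_kernel z x) \<le> 1 / Im z" for x
        unfolding cauchy_kernel_def norm_divide using z abs_Im_le_cmod[of "z - of_real x"] by (auto intro!: frac_le)
    qed
    then have "(\<lambda>n. g (z + \<i> * of_real (y (r n)))) \<longlonglongrightarrow> cauchy_transform R z"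
      using boundary_measure_cauchy[OF y(1) z] by (simp add: cauchy_transform_kernel)
    moreover have "(\<lambda>n. g (z + \<i> * of_real (y (r n)))) \<longlonglongrightarrow> g (z + \<i> * of_real 0)"
    proof (rule continuous_on_tendsto_compose[OF holomorphic_on_imp_continuous_on[OF holo]])
      have "y \<longlonglongrightarrow> 0" unfolding y_def by real_asymp
      then have "(\<lambda>n. y (r n)) \<longlonglongrightarrow> 0" using LIMSEQ_subseq_LIMSEQ[OF _ r] by (fastforce simp: o_def)
      then show "(\<lambda>n. z + \<i> * of_real (y (r n))) \<longlonglongrightarrow> z + \<i> * of_real 0" by (intro tendsto_intros)
      show "\<forall>\<^sub>F n in sequentially. z + \<i> * of_real (y (r n)) \<in> {z. 0 < Im z}"
        using z y by (auto intro!: always_eventually add_pos_pos)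
    qed (use z in auto)
    ultimately show ?thesis using LIMSEQ_unique by fastforce
  qed
  moreover have "borel_prob R"
    unfolding borel_prob_def using R.prob_space_axioms R.events_eq_borel by blast
  ultimately show ?thesis by blast
qed

end

section \<open>Stieltjes inversion\<close>

text \<open>At height y, -Im G integrates the Poisson kernels y / ((x - t)^2 + y^2) over t;
  Tonelli's theorem and the antiderivative arctan ((x - t) / y) do the rest.\<close>

lemma (in borel_distribution) stieltjes_inversion:
  assumes y: "y > 0" and ab: "a \<le> b"
  shows "(\<integral>\<^sup>+x. ennreal (- Im (cauchy_transform M (of_real x + \<i> * of_real y))) * indicator {a..b} x \<partial>lborel)
     = ennreal (\<integral>t. arctan ((b - t) / y) - arctan ((a - t) / y) \<partial>M)"
proof -
  define p where "p x t = y / ((x - t)\<^sup>2 + y\<^sup>2)" for x t :: real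
  have pos: "(x - t)\<^sup>2 + y\<^sup>2 > 0" for x t using y by (simp add: add_nonneg_pos)
  have p0: "p x t \<ge> 0" for x t using y by (simp add: p_def)
  have pck: "y * (cmod (cauchy_kernel (of_real x + \<i> * of_real y) t))\<^sup>2 = p x t" for x t
    by (simp add: cauchy_kernel_def p_def norm_divide cmod_power2 power_divide)
  have [measurable]: "(\<lambda>(x, t). p x t) \<in> borel_measurable (lborel \<Otimes>\<^sub>M M)"
    unfolding p_def by measurable
  have "ennreal (- Im (cauchy_transform M (of_real x + \<i> * of_real y))) = (\<integral>\<^sup>+t. ennreal (p x t) \<partial>M)" for x
  proof -
    have off: "off_measure M (of_real x + \<i> * of_real y)" using y by (intro off_measureI_Im) simp
    have "integrable M (\<lambda>t. y * (cmod (cauchy_kernel (of_real x + \<i> * of_real y) t))\<^sup>2)"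
      by (intro integrable_mult_right kernel_norm2_integrable off)
    then have "integrable M (p x)" unfolding pck .
    moreover have "- Im (cauchy_transform M (of_real x + \<i> * of_real y)) = (\<integral>t. p x t \<partial>M)"
      unfolding Im_cauchy_transform[OF off] pck[symmetric] by simp
    ultimately show ?thesis using p0 by (subst nn_integral_eq_integral) auto
  qed
  then have "(\<integral>\<^sup>+x. ennreal (- Im (cauchy_transform M (of_real x + \<i> * of_real y))) * indicator {a..b} x \<partial>lborel)
     = (\<integral>\<^sup>+x. (\<integral>\<^sup>+t. ennreal (p x t) * indicator {a..b} x \<partial>M) \<partial>lborel)"
    by (simp add: nn_integral_multc)
  also have "\<dots> = (\<integral>\<^sup>+t. (\<integral>\<^sup>+x. ennreal (p x t) * indicator {a..b} x \<partial>lborel) \<partial>M)"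
  proof -
    interpret pair_sigma_finite lborel M ..
    show ?thesis by (rule Fubini'[symmetric]) measurable
  qed
  also have "\<dots> = (\<integral>\<^sup>+t. ennreal (arctan ((b - t) / y) - arctan ((a - t) / y)) \<partial>M)"
  proof (rule nn_integral_cong)
    fix t
    show "(\<integral>\<^sup>+x. ennreal (p x t) * indicator {a..b} x \<partial>lborel) = ennreal (arctan ((b - t) / y) - arctan ((a - t) / y))"
    proof (rule nn_integral_FTC_Icc)
      fix x
      have "((\<lambda>x. arctan ((x - t) / y)) has_real_derivative (inverse (1 + ((x - t) / y)\<^sup>2) * (1 / y))) (at x)"
        using y by (auto intro!: derivative_eq_intros)
      moreover have "inverse (1 + ((x - t) / y)\<^sup>2) * (1 / y) = p x t"
        using y pos[of x t] by (simp add: p_def power_divide) (simp add: divide_simps, simp add: power2_eq_square algebra_simps)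
      ultimately show "((\<lambda>x. arctan ((x - t) / y)) has_real_derivative p x t) (at x)" by simp
    qed (use ab p0 in \<open>simp_all add: p_def[abs_def]\<close>)
  qed
  also have "\<dots> = ennreal (\<integral>t. arctan ((b - t) / y) - arctan ((a - t) / y) \<partial>M)"
  proof (rule nn_integral_eq_integral)
    show "integrable M (\<lambda>t. arctan ((b - t) / y) - arctan ((a - t) / y))"
    proof (rule integrable_bound)
      show "AE t in M. norm (arctan ((b - t) / y) - arctan ((a - t) / y)) \<le> pi"
      proof (rule AE_I2)
        fix t show "norm (arctan ((b - t) / y) - arctan ((a - t) / y)) \<le> pi"
          using arctan_bounded[of "(b - t) / y"] arctan_bounded[of "(a - t) / y"] by (simp add: abs_if)
      qed
    qed measurable
    show "AE t in M. 0 \<le> arctan ((b - t) / y) - arctan ((a - t) / y)"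
      using ab y by (intro AE_I2) (simp add: arctan_monotone' divide_right_mono)
  qed
  finally show ?thesis .
qed

definition arctan_limit :: "real \<Rightarrow> real" where
  "arctan_limit s = pi / 2 * sgn s"

lemma arctan_limit: "(\<lambda>n. arctan (s * real (Suc n))) \<longlonglongrightarrow> arctan_limit s"
proof (cases s "0::real" rule: linorder_cases)
  case less
  then have "filterlim (\<lambda>n. s * real (Suc n)) at_bot sequentially" by real_asymp
  from filterlim_compose[OF tendsto_arctan_at_bot this] show ?thesis using less by (simp add: arctan_limit_def)
next
  case greater
  then have "filterlim (\<lambda>n. s * real (Suc n)) at_top sequentially" by real_asymp
  from filterlim_compose[OF tendsto_arctan_at_top this] show ?thesis using greater by (simp add: arctan_limit_def)
qed (simp add: arctan_limit_def)

text \<open>The average of the distribution function and its left limit. It arises because arctan 0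
  = 0 lets an atom at an endpoint count with half its mass in the limit.\<close>

definition mid_cdf :: "real measure \<Rightarrow> real \<Rightarrow> real" where
  "mid_cdf M b = (measure M {..b} + measure M {..<b}) / 2"

lemma (in borel_distribution) stieltjes_limit:
  assumes ab: "a \<le> b"
  shows "(\<lambda>n. \<integral>t. arctan ((b - t) * real (Suc n)) - arctan ((a - t) * real (Suc n)) \<partial>M)
    \<longlonglongrightarrow> pi * (mid_cdf M b - mid_cdf M a)"
proof -
  have "(\<lambda>n. \<integral>t. arctan ((b - t) * real (Suc n)) - arctan ((a - t) * real (Suc n)) \<partial>M)
     \<longlonglongrightarrow> (\<integral>t. arctan_limit (b - t) - arctan_limit (a - t) \<partial>M)"
  proof (rule integral_dominated_convergence[where w = "\<lambda>_. pi"])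
    show "AE t in M. norm (arctan ((b - t) * real (Suc n)) - arctan ((a - t) * real (Suc n))) \<le> pi" for n
    proof (rule AE_I2)
      fix t show "norm (arctan ((b - t) * real (Suc n)) - arctan ((a - t) * real (Suc n))) \<le> pi"
        using arctan_bounded[of "(b - t) * real (Suc n)"] arctan_bounded[of "(a - t) * real (Suc n)"] by (simp add: abs_if)
    qed
    show "AE t in M. (\<lambda>n. arctan ((b - t) * real (Suc n)) - arctan ((a - t) * real (Suc n)))
       \<longlonglongrightarrow> arctan_limit (b - t) - arctan_limit (a - t)"
      by (intro AE_I2 tendsto_diff arctan_limit)
  qed (auto simp: arctan_limit_def)
  also have "(\<integral>t. arctan_limit (b - t) - arctan_limit (a - t) \<partial>M) =
     (\<integral>t. pi / 2 * (indicator {..b} t + indicator {..<b} t - indicator {..a} t - indicator {..<a} t) \<partial>M)"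
    by (rule Bochner_Integration.integral_cong) (auto simp: arctan_limit_def sgn_if indicator_def)
  also have "\<dots> = pi * (mid_cdf M b - mid_cdf M a)"
    by (simp add: mid_cdf_def emeasure_eq_measure field_simps)
  finally show ?thesis .
qed

text \<open>Stieltjes inversion determines the increments of \<open>mid_cdf\<close>; sending the
  left endpoint to minus infinity fixes \<open>mid_cdf\<close> itself, and its right limits are the
  distribution function.\<close>

theorem cauchy_transform_unique:
  assumes R: "borel_prob R" and R': "borel_prob R'"
    and eq: "\<And>z. Im z > 0 \<Longrightarrow> cauchy_transform R z = cauchy_transform R' z"
  shows "R = R'"
proof -
  interpret R: borel_distribution R
    using R by (simp add: borel_prob_def borel_distribution_def borel_distribution_axioms_def)
  interpret R': borel_distribution R'
    using R' by (simp add: borel_prob_def borel_distribution_def borel_distribution_axioms_def)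
  interpret RD: real_distribution R by unfold_locales auto
  interpret RD': real_distribution R' by unfold_locales auto
  have diff: "mid_cdf R b - mid_cdf R a = mid_cdf R' b - mid_cdf R' a" if ab: "a \<le> b" for a b
  proof -
    have "(\<integral>t. arctan ((b - t) / y) - arctan ((a - t) / y) \<partial>R) = (\<integral>t. arctan ((b - t) / y) - arctan ((a - t) / y) \<partial>R')"
      if y: "y > 0" for y
    proof -
      have nn: "0 \<le> (\<integral>t. arctan ((b - t) / y) - arctan ((a - t) / y) \<partial>N)" for N :: "real measure"
        using ab y by (intro Bochner_Integration.integral_nonneg) (simp add: arctan_monotone' divide_right_mono)
      have "ennreal (\<integral>t. arctan ((b - t) / y) - arctan ((a - t) / y) \<partial>R) = ennreal (\<integral>t. arctan ((b - t) / y) - arctan ((a - t) / y) \<partial>R')"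
        unfolding R.stieltjes_inversion[OF y ab, symmetric] R'.stieltjes_inversion[OF y ab, symmetric]
        using y by (subst eq) auto
      then show ?thesis using nn by (simp add: ennreal_inj)
    qed
    from this[of "1 / real (Suc _)"] have int_eq:
     "(\<integral>t. arctan ((b - t) * real (Suc n)) - arctan ((a - t) * real (Suc n)) \<partial>R) =
        (\<integral>t. arctan ((b - t) * real (Suc n)) - arctan ((a - t) * real (Suc n)) \<partial>R')" for n
      by (simp del: of_nat_Suc)
    have "pi * (mid_cdf R b - mid_cdf R a) = pi * (mid_cdf R' b - mid_cdf R' a)"
      by (rule LIMSEQ_unique[OF R.stieltjes_limit[OF ab]]) (simp only: int_eq R'.stieltjes_limit[OF ab])
    then show ?thesis by simp
  qed
  have bot: "(mid_cdf N \<longlongrightarrow> 0) at_bot" if "real_distribution N" for N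
  proof -
    interpret real_distribution N by (rule that)
    show ?thesis
    proof (rule tendsto_sandwich[where f = "\<lambda>_. 0" and h = "cdf N"])
      show "\<forall>\<^sub>F x in at_bot. mid_cdf N x \<le> cdf N x"
        by (auto simp: mid_cdf_def cdf_def2 intro!: always_eventually finite_measure_mono)
    qed (auto simp: mid_cdf_def cdf_lim_at_bot)
  qed
  have mid: "mid_cdf R b = mid_cdf R' b" for b
  proof -
    have "((\<lambda>a. mid_cdf R b - mid_cdf R a) \<longlongrightarrow> mid_cdf R b - 0) at_bot"
      by (intro tendsto_intros bot) (rule RD.real_distribution_axioms)
    moreover have "\<forall>\<^sub>F a in at_bot. mid_cdf R b - mid_cdf R a = mid_cdf R' b - mid_cdf R' a"
      using eventually_le_at_bot[of b] by eventually_elim (rule diff)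
    ultimately have "((\<lambda>a. mid_cdf R' b - mid_cdf R' a) \<longlongrightarrow> mid_cdf R b - 0) at_bot"
      by (rule Lim_transform_eventually)
    moreover have "((\<lambda>a. mid_cdf R' b - mid_cdf R' a) \<longlongrightarrow> mid_cdf R' b - 0) at_bot"
      by (intro tendsto_intros bot) (rule RD'.real_distribution_axioms)
    ultimately have "mid_cdf R b - 0 = mid_cdf R' b - 0"
      by (intro tendsto_unique[of at_bot]) auto
    then show ?thesis by simp
  qed
  \<comment> \<open>For x > a the value at x lies between \<open>cdf N a\<close> and
    \<open>cdf N x\<close>, so right continuity of \<open>cdf N\<close> squeezes it.\<close>
  have right: "(mid_cdf N \<longlongrightarrow> cdf N a) (at_right a)" if "real_distribution N" for N a
  proof -
    interpret real_distribution N by (rule that)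
    show ?thesis
    proof (rule tendsto_sandwich[where f = "\<lambda>_. cdf N a" and h = "cdf N"])
      show "(cdf N \<longlongrightarrow> cdf N a) (at_right a)"
        using cdf_is_right_cont[of a] by (simp add: continuous_within)
      show "\<forall>\<^sub>F x in at_right a. mid_cdf N x \<le> cdf N x"
        by (auto simp: mid_cdf_def cdf_def2 intro!: always_eventually finite_measure_mono)
      show "\<forall>\<^sub>F x in at_right a. cdf N a \<le> mid_cdf N x"
        using eventually_at_right_less[of a]
      proof eventually_elim
        case (elim x)
        then have "measure N {..a} \<le> measure N {..<x}" "measure N {..<x} \<le> measure N {..x}"
          by (auto intro!: finite_measure_mono)
        then show ?case by (simp add: mid_cdf_def cdf_def2)
      qed
    qed auto
  qed
  have "cdf R = cdf R'"
  proof
    fix a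
    have "(mid_cdf R \<longlongrightarrow> cdf R a) (at_right a)"
      by (rule right) (rule RD.real_distribution_axioms)
    moreover have "(mid_cdf R \<longlongrightarrow> cdf R' a) (at_right a)"
      unfolding mid[abs_def] by (rule right) (rule RD'.real_distribution_axioms)
    ultimately show "cdf R a = cdf R' a" by (intro tendsto_unique[of "at_right a"]) auto
  qed
  then show ?thesis by (rule cdf_unique[OF RD.real_distribution_axioms RD'.real_distribution_axioms])
qed

section \<open>Boolean powers\<close>

lemma borel_prob_iff: "borel_prob M \<longleftrightarrow> borel_distribution M"
  by (auto simp: borel_prob_def borel_distribution_def borel_distribution_axioms_def)

lemma K_transform_unique:
  assumes "borel_prob R" "borel_prob R'"
    and "\<And>z. Im z > 0 \<Longrightarrow> K_transform R z = K_transform R' z"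
  shows "R = R'"
proof (rule cauchy_transform_unique[OF assms(1,2)])
  fix z assume "Im z > 0"
  from assms(3)[OF this] have "F_transform R z = F_transform R' z"
    by (simp add: K_transform_def)
  then show "cauchy_transform R z = cauchy_transform R' z"
    by (simp add: F_transform_def)
qed

text \<open>Uniqueness discharges the definite description, so exhibiting one measure with the right
  K-transform identifies the convolution.\<close>

lemma boolean_conv_eqI:
  assumes "borel_prob R"
    and "\<And>z. Im z > 0 \<Longrightarrow> K_transform R z = K_transform M z + K_transform N z"
  shows "boolean_conv M N = R"
  unfolding boolean_conv_def
proof (rule the_equality)
  fix R' assume "borel_prob R' \<and> (\<forall>z. 0 < Im z \<longrightarrow> K_transform R' z = K_transform M z + K_transform N z)"
  then show "R' = R" using assms by (intro K_transform_unique) auto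
qed (use assms in blast)

context standardized_distribution
begin

text \<open>Since Im K <= 0, the function F = z - c K satisfies Im F >= Im z, and z / F - 1 = c K /
  F is then at most c / (Im z)^2 in modulus. Hence the Herglotz representation covers 1 / F.\<close>

lemma exists_K_transform_multiple:
  assumes c: "c \<ge> 0"
  shows "\<exists>R. borel_prob R \<and> (\<forall>z. Im z > 0 \<longrightarrow> K_transform R z = of_real c * K_transform M z)"
proof -
  define F where "F z = z - of_real c * K_transform M z" for z
  define g where "g z = 1 / F z" for z
  have ImF: "Im (F z) \<ge> Im z" if "Im z > 0" for z
    using Im_K_transform_nonpos[OF that] c by (simp add: F_def mult_nonneg_nonpos)
  have F0: "F z \<noteq> 0" if "Im z > 0" for z using ImF[OF that] that by auto
  have "nevanlinna_normalized g c"
  proof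
    show "g holomorphic_on {z. 0 < Im z}"
      unfolding g_def using F0 by (intro holomorphic_intros) (auto simp: F_def[abs_def] intro!: holomorphic_intros K_transform_holomorphic)
  next
    fix z assume z: "Im z > 0"
    show "Im (g z) \<le> 0"
      using ImF[OF z] z by (simp add: g_def Im_divide divide_nonpos_nonneg)
    have "z * g z - 1 = of_real c * K_transform M z / F z"
      using F0[OF z] by (simp add: g_def F_def field_simps)
    then have "cmod (z * g z - 1) = c * cmod (K_transform M z) / cmod (F z)"
      using c by (simp add: norm_mult norm_divide)
    also have "\<dots> \<le> c * (1 / Im z) / Im z"
    proof (intro frac_le mult_left_mono norm_K_transform_le z c)
      show "Im z \<le> cmod (F z)" using ImF[OF z] abs_Im_le_cmod[of "F z"] by linarith
    qed (use z c in auto)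
    finally show "cmod (z * g z - 1) \<le> c / (Im z)\<^sup>2" by (simp add: power2_eq_square)
  qed
  then obtain R where R: "borel_prob R" "\<And>z. Im z > 0 \<Longrightarrow> cauchy_transform R z = g z"
    using nevanlinna_normalized.herglotz_representation by blast
  moreover have "K_transform R z = of_real c * K_transform M z" if "Im z > 0" for z
    using R(2)[OF that] by (simp add: K_transform_def F_transform_def g_def F_def)
  ultimately show ?thesis by blast
qed

text \<open>Each successor power is obtained directly from the multiple of K by
  \<open>exists_K_transform_multiple\<close>; the induction only identifies it with the iterated
  convolution.\<close>

lemma boolean_power_K_transform:
  "borel_prob (boolean_power M n) \<and>
    (\<forall>z. Im z > 0 \<longrightarrow> K_transform (boolean_power M n) z = of_nat n * K_transform M z)"
proof (induction n)
  case 0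
  have "borel_prob (return borel (0::real))"
    by (simp add: borel_prob_def prob_space_return)
  moreover have "cauchy_transform (return borel (0::real)) z = 1 / z" for z
    unfolding cauchy_transform_kernel by (subst integral_return) (auto simp: cauchy_kernel_def)
  ultimately show ?case by (simp add: K_transform_def F_transform_def)
next
  case (Suc n)
  obtain R where R: "borel_prob R" "\<And>z. Im z > 0 \<Longrightarrow> K_transform R z = of_real (real (Suc n)) * K_transform M z"
    using exists_K_transform_multiple[of "real (Suc n)"] by auto
  have "boolean_power M (Suc n) = R"
    using R Suc by (auto intro!: boolean_conv_eqI simp: algebra_simps)
  then show ?case using R by simp
qed

end

section \<open>Boundary behaviour of the Cauchy transform\<close>

text \<open>Lindelof's theorem reduces the cover by null balls to a countable one.\<close>

lemma emeasure_open_locally_null: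
  assumes sets: "sets M = sets borel" and U: "open (U :: real set)"
    and null: "\<And>x. x \<in> U \<Longrightarrow> \<exists>e>0. emeasure M (ball x e) = 0"
  shows "emeasure M U = 0"
proof -
  obtain e where e: "\<And>x. x \<in> U \<Longrightarrow> e x > 0 \<and> emeasure M (ball x (e x)) = 0"
    using null by metis
  define \<F> where "\<F> = (\<lambda>x. ball x (e x)) ` U"
  obtain \<F>' where F': "\<F>' \<subseteq> \<F>" "countable \<F>'" "\<Union>\<F>' = \<Union>\<F>"
    using Lindelof[of \<F>] unfolding \<F>_def by auto
  have "(\<Union>S\<in>\<F>'. S) \<in> null_sets M"
    by (rule null_sets_UN'[OF F'(2)]) (use F'(1) e sets in \<open>auto simp: \<F>_def null_sets_def\<close>)
  moreover have "U \<subseteq> (\<Union>S\<in>\<F>'. S)"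
    using e F'(3) by (force simp: \<F>_def)
  ultimately have "U \<in> null_sets M"
    using null_sets_subset U sets by (metis borel_open)
  then show ?thesis by (simp add: null_sets_def)
qed

context borel_distribution
begin

text \<open>The Poisson kernel y / ((x - t)^2 + y^2) is at least 1 / (2 y) when |x - t| <=
  y.\<close>

lemma measure_interval_le_cauchy:
  assumes y: "y > 0"
  shows "measure M {x - y..x + y} \<le> 2 * y * - Im (cauchy_transform M (of_real x + \<i> * of_real y))"
proof -
  have off: "off_measure M (of_real x + \<i> * of_real y)" using y by (intro off_measureI_Im) simp
  have "measure M {x - y..x + y} = (\<integral>t. indicator {x - y..x + y} t \<partial>M)" by simp
  also have "\<dots> \<le> (\<integral>t. 2 * y\<^sup>2 * (cmod (cauchy_kernel (of_real x + \<i> * of_real y) t))\<^sup>2 \<partial>M)"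
  proof (intro integral_mono_AE AE_I2)
    fix t
    have pos: "(x - t)\<^sup>2 + y\<^sup>2 > 0" using y by (simp add: add_nonneg_pos)
    have "2 * y\<^sup>2 * (cmod (cauchy_kernel (of_real x + \<i> * of_real y) t))\<^sup>2 = 2 * y\<^sup>2 / ((x - t)\<^sup>2 + y\<^sup>2)"
      by (simp add: cauchy_kernel_def norm_divide cmod_power2 power_divide)
    moreover have "1 \<le> 2 * y\<^sup>2 / ((x - t)\<^sup>2 + y\<^sup>2)" if "t \<in> {x - y..x + y}"
    proof -
      have "\<bar>x - t\<bar> \<le> \<bar>y\<bar>" using that by auto
      then have "(x - t)\<^sup>2 \<le> y\<^sup>2" by (simp only: abs_le_square_iff)
      then show ?thesis using pos by simp
    qed
    ultimately show "indicator {x - y..x + y} t \<le> 2 * y\<^sup>2 * (cmod (cauchy_kernel (of_real x + \<i> * of_real y) t))\<^sup>2"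
      by (simp split: split_indicator)
  next
    show "integrable M (\<lambda>t. 2 * y\<^sup>2 * (cmod (cauchy_kernel (of_real x + \<i> * of_real y) t))\<^sup>2)"
      by (intro integrable_mult_right kernel_norm2_integrable off)
  qed (auto simp: emeasure_eq_measure)
  also have "\<dots> = 2 * y * - Im (cauchy_transform M (of_real x + \<i> * of_real y))"
    by (simp add: Im_cauchy_transform[OF off] power2_eq_square)
  finally show ?thesis .
qed

text \<open>A difference quotient of the distribution function over distance y is at most 2 |Im G|
  at height y. Vanishing boundary values therefore give derivative 0 at every point, so pointwise
  limits are enough to make the distribution function constant.\<close>

lemma interval_null_of_cauchy_boundary:
  assumes ac: "a < c"
    and lim: "\<And>x s. \<lbrakk>a < x; x < c; \<And>n. s n > 0; s \<longlonglongrightarrow> 0\<rbrakk> \<Longrightarrow>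
      (\<lambda>n. Im (cauchy_transform M (of_real x + \<i> * of_real (s n)))) \<longlonglongrightarrow> 0"
  shows "\<lbrakk>a < u; u \<le> v; v < c\<rbrakk> \<Longrightarrow> measure M {u<..v} = 0"
proof -
  interpret real_distribution M by unfold_locales auto
  assume uv: "a < u" "u \<le> v" "v < c"
  have deriv: "(cdf M has_real_derivative 0) (at x)" if x: "a < x" "x < c" for x
    unfolding has_field_derivative_iff
  proof (subst tendsto_at_iff_sequentially, intro allI impI)
    fix s :: "nat \<Rightarrow> real"
    assume s: "\<forall>i. s i \<in> UNIV - {x}" "s \<longlonglongrightarrow> x"
    \<comment> \<open>The height is tied to the increment, so that the interval of radius
      \<open>y n\<close> around x covers the step from x to \<open>s n\<close>.\<close>
    define y where "y n = \<bar>s n - x\<bar>" for n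
    have y: "y n > 0" for n using s(1) by (auto simp: y_def)
    have "y \<longlonglongrightarrow> 0" unfolding y_def[abs_def] using s(2) by (simp add: LIM_zero tendsto_rabs_zero)
    then have lim0: "(\<lambda>n. 2 * \<bar>Im (cauchy_transform M (of_real x + \<i> * of_real (y n)))\<bar>) \<longlonglongrightarrow> 0"
      by (intro tendsto_mult_right_zero tendsto_rabs_zero lim x y)
    have "(\<lambda>n. (cdf M (s n) - cdf M x) / (s n - x)) \<longlonglongrightarrow> 0"
    proof (rule Lim_null_comparison[OF _ lim0])
      show "\<forall>\<^sub>F n in sequentially. norm ((cdf M (s n) - cdf M x) / (s n - x)) \<le>
         2 * \<bar>Im (cauchy_transform M (of_real x + \<i> * of_real (y n)))\<bar>"
      proof (rule always_eventually, rule allI)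
        fix n
        have "\<bar>cdf M (s n) - cdf M x\<bar> \<le> measure M {x - y n..x + y n}"
        proof (cases "x < s n")
          case True
          then have "\<bar>cdf M (s n) - cdf M x\<bar> = measure M {x<..s n}"
            by (simp add: cdf_diff_eq)
          also have "\<dots> \<le> measure M {x - y n..x + y n}"
            by (intro finite_measure_mono) (use True in \<open>auto simp: y_def\<close>)
          finally show ?thesis .
        next
          case False
          then have less: "s n < x" using y[of n] by (simp add: y_def)
          then have "\<bar>cdf M (s n) - cdf M x\<bar> = measure M {s n<..x}"
            using cdf_diff_eq[OF less] by (simp add: abs_minus_commute)
          also have "\<dots> \<le> measure M {x - y n..x + y n}"
            by (intro finite_measure_mono) (use less in \<open>auto simp: y_def\<close>)
          finally show ?thesis .
        qed
        also have "\<dots> \<le> 2 * y n * - Im (cauchy_transform M (of_real x + \<i> * of_real (y n)))"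
          by (rule measure_interval_le_cauchy[OF y])
        also have "\<dots> \<le> 2 * y n * \<bar>Im (cauchy_transform M (of_real x + \<i> * of_real (y n)))\<bar>"
          using y[of n] by (intro mult_left_mono) auto
        finally show "norm ((cdf M (s n) - cdf M x) / (s n - x)) \<le>
         2 * \<bar>Im (cauchy_transform M (of_real x + \<i> * of_real (y n)))\<bar>"
          using y[of n] by (simp add: y_def[symmetric] field_simps)
      qed
    qed
    then show "((\<lambda>y. (cdf M y - cdf M x) / (y - x)) \<circ> s) \<longlonglongrightarrow> 0" by (simp add: o_def)
  qed
  show ?thesis
  proof (cases "u = v")
    case False
    then have "u < v" using uv by simp
    have "cdf M v = cdf M u"
      by (rule DERIV_isconst2[OF \<open>u < v\<close>])
         (use uv \<open>u < v\<close> in \<open>auto intro!: deriv continuous_at_imp_continuous_on DERIV_isCont[OF deriv]\<close>)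
    then show ?thesis using cdf_diff_eq[OF \<open>u < v\<close>] by simp
  qed simp
qed

text \<open>The functions i s / (x + i s - t) are bounded by 1 and tend to the indicator of t = x as
  s decreases to 0.\<close>

lemma atom_limit:
  assumes s: "\<And>n. s n > 0" "s \<longlonglongrightarrow> 0"
  shows "(\<lambda>n. \<i> * of_real (s n) * cauchy_transform M (of_real x + \<i> * of_real (s n))) \<longlonglongrightarrow> of_real (measure M {x})"
proof -
  have "(\<lambda>n. \<integral>t. \<i> * of_real (s n) * cauchy_kernel (of_real x + \<i> * of_real (s n)) t \<partial>M) \<longlonglongrightarrow> (\<integral>t. indicator {x} t \<partial>M)"
  proof (rule integral_dominated_convergence[where w = "\<lambda>_. 1"])
    show "AE t in M. norm (\<i> * of_real (s n) * cauchy_kernel (of_real x + \<i> * of_real (s n)) t) \<le> 1" for n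
    proof (rule AE_I2)
      fix t
      have "s n \<le> cmod (of_real x + \<i> * of_real (s n) - of_real t)"
        using abs_Im_le_cmod[of "of_real x + \<i> * of_real (s n) - of_real t"] s(1)[of n] by simp
      then show "norm (\<i> * of_real (s n) * cauchy_kernel (of_real x + \<i> * of_real (s n)) t) \<le> 1"
        using s(1)[of n] by (simp add: norm_mult cauchy_kernel_def norm_divide divide_le_eq)
    qed
    show "AE t in M. (\<lambda>n. \<i> * of_real (s n) * cauchy_kernel (of_real x + \<i> * of_real (s n)) t) \<longlonglongrightarrow> indicator {x} t"
    proof (rule AE_I2)
      fix t
      show "(\<lambda>n. \<i> * of_real (s n) * cauchy_kernel (of_real x + \<i> * of_real (s n)) t) \<longlonglongrightarrow> indicator {x} t"
      proof (cases "t = x")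
        case True
        have "\<i> * of_real (s n) * cauchy_kernel (of_real x + \<i> * of_real (s n)) t = 1" for n
          using s(1)[of n] True by (simp add: cauchy_kernel_def)
        then show ?thesis using True by simp
      next
        case False
        have "(\<lambda>n. \<i> * of_real (s n) * (1 / (of_real x + \<i> * of_real (s n) - of_real t)))
            \<longlonglongrightarrow> \<i> * of_real 0 * (1 / (of_real x + \<i> * of_real 0 - of_real t))"
          by (intro tendsto_intros s) (use False in \<open>auto simp flip: of_real_diff\<close>)
        then show ?thesis using False by (simp add: cauchy_kernel_def)
      qed
    qed
  qed auto
  moreover have "(\<integral>t. indicator {x} t \<partial>M) = complex_of_real (measure M {x})"
  proof -
    have "(\<integral>t. indicator {x} t \<partial>M) = (\<integral>t. complex_of_real (indicator {x} t) \<partial>M)"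
      by (rule Bochner_Integration.integral_cong) (auto simp: indicator_def)
    also have "\<dots> = of_real (\<integral>t. indicator {x} t \<partial>M)"
      by (rule integral_of_real) (rule integrable_bound[where B = 1], auto simp: indicator_def)
    finally show ?thesis by simp
  qed
  moreover have "(\<integral>t. \<i> * of_real (s n) * cauchy_kernel (of_real x + \<i> * of_real (s n)) t \<partial>M) =
      \<i> * of_real (s n) * cauchy_transform M (of_real x + \<i> * of_real (s n))" for n
    by (simp add: cauchy_transform_kernel)
  ultimately show ?thesis by (simp only:)
qed

end

section \<open>The transforms on the real line beyond the support\<close>

text \<open>Clearing denominators leaves 2 s^3 <= (s + b) (s^2 + X^2). For X < s the hypothesis
  gives X^2 >= s^2 - b s, and (s + b) (2 s^2 - b s) exceeds 2 s^3 by b s (s - b).\<close>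

lemma atom_upper_numeric:
  fixes s b X :: real
  assumes "0 < b" "b < s" "0 < X" "s\<^sup>2 \<le> X\<^sup>2 + b * X"
  shows "1 / (1 + X\<^sup>2 / s\<^sup>2) \<le> 1/2 + b / (2 * s)"
proof -
  have "2 * s^3 \<le> (s + b) * (s\<^sup>2 + X\<^sup>2)"
  proof (cases "X \<ge> s")
    case True
    then have "s\<^sup>2 \<le> X\<^sup>2" using assms by simp
    then have "s * (2 * s\<^sup>2) \<le> (s + b) * (s\<^sup>2 + X\<^sup>2)" using assms by (intro mult_mono) auto
    then show ?thesis by (simp add: power3_eq_cube power2_eq_square)
  next
    case False
    then have "b * X \<le> b * s" using assms by simp
    then have "2 * s\<^sup>2 - b * s \<le> s\<^sup>2 + X\<^sup>2" using assms(4) by linarith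
    then have "(s + b) * (2 * s\<^sup>2 - b * s) \<le> (s + b) * (s\<^sup>2 + X\<^sup>2)" using assms by (intro mult_left_mono) auto
    moreover have "(s + b) * (2 * s\<^sup>2 - b * s) = 2 * s^3 + b * s * (s - b)"
      by (simp add: algebra_simps power3_eq_cube power2_eq_square)
    moreover have "b * s * (s - b) \<ge> 0" using assms by simp
    ultimately show ?thesis by linarith
  qed
  moreover have "s\<^sup>2 + X\<^sup>2 > 0" using assms by (simp add: add_pos_pos)
  moreover have "1 / (1 + X\<^sup>2 / s\<^sup>2) = s\<^sup>2 / (s\<^sup>2 + X\<^sup>2)" using assms by (simp add: field_simps)
  moreover have "1/2 + b / (2 * s) = (s + b) / (2 * s)" using assms by (simp add: field_simps)
  ultimately show ?thesis using assms
    by (simp add: frac_le_eq divide_le_0_iff) (simp add: algebra_simps power3_eq_cube power2_eq_square)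
qed

text \<open>With r = 1 - 2 b / s one has X - b >= r s, and the claim reduces to r - 1/2 < r^2 / (1 +
  r^2). After clearing denominators the two sides differ by (1 - r) (r^2 - r / 2 + 1 / 2), which is
  positive for r < 1.\<close>

lemma atom_lower_numeric:
  fixes s b X :: real
  assumes "0 < b" "0 < s" "b \<le> s / 4" "s - b \<le> X"
  shows "1/2 - 2 * b / s < 1 / (1 + s\<^sup>2 / (X - b)\<^sup>2)"
proof -
  define r where "r = 1 - 2 * b / s"
  have r: "1/2 \<le> r" "r < 1" using assms by (auto simp: r_def field_simps)
  have "r * s = s - 2 * b" using assms by (simp add: r_def field_simps)
  then have "r * s \<le> X - b" using assms by simp
  then have "(r * s)\<^sup>2 \<le> (X - b)\<^sup>2" using r assms by (intro power_mono) auto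
  then have "s\<^sup>2 / (X - b)\<^sup>2 \<le> s\<^sup>2 / (r * s)\<^sup>2" using r assms by (intro divide_left_mono mult_pos_pos) auto
  also have "\<dots> = 1 / r\<^sup>2" using assms by (simp add: power_mult_distrib)
  finally have le: "1 / (1 + 1 / r\<^sup>2) \<le> 1 / (1 + s\<^sup>2 / (X - b)\<^sup>2)"
    by (intro divide_left_mono) (auto intro!: mult_pos_pos add_pos_nonneg)
  have "0 < (1 - r) * (r\<^sup>2 - r / 2 + 1 / 2)"
  proof (intro mult_pos_pos)
    have "r\<^sup>2 - r / 2 + 1 / 2 = (r - 1/4)\<^sup>2 + 7/16" by (simp add: power2_eq_square algebra_simps)
    then show "0 < r\<^sup>2 - r / 2 + 1 / 2" by (simp add: add_nonneg_pos)
  qed (use r in simp)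
  also have "\<dots> = r\<^sup>2 - (r - 1/2) * (1 + r\<^sup>2)" by (simp add: power2_eq_square field_simps)
  finally have "(r - 1/2) * (1 + r\<^sup>2) < r\<^sup>2" by simp
  then have "r - 1/2 < r\<^sup>2 / (1 + r\<^sup>2)" by (simp add: less_divide_eq add_pos_nonneg)
  also have "r\<^sup>2 / (1 + r\<^sup>2) = 1 / (1 + 1 / r\<^sup>2)" using r by (simp add: field_simps)
  finally show ?thesis using le by (simp add: r_def)
qed

locale bounded_standardized_distribution = standardized_distribution M for M +
  fixes b :: real
  assumes b_pos: "b > 0" and bounded: "AE t in M. \<bar>t\<bar> \<le> b"
begin

text \<open>Real versions of the transforms to the right of the support. \<open>P\<close> is the
  integral in the resolvent identity; on the diagonal it is minus the derivative of
  \<open>G\<close>.\<close>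

definition G :: "real \<Rightarrow> real" where "G x = (\<integral>t. 1 / (x - t) \<partial>M)"
definition P :: "real \<Rightarrow> real \<Rightarrow> real" where "P x x' = (\<integral>t. 1 / (x - t) * (1 / (x' - t)) \<partial>M)"
definition k :: "real \<Rightarrow> real" where "k x = x - 1 / G x"

lemma off_measure_Re: assumes "Re z > b" shows "off_measure M z"
  unfolding off_measure_def
proof (intro exI conjI)
  show "AE t in M. Re z - b \<le> cmod (z - of_real t)"
    using bounded
  proof eventually_elim
    case (elim t)
    then show ?case using abs_Re_le_cmod[of "z - of_real t"] by simp
  qed
qed (use assms in simp)

context
  fixes x :: real
  assumes x: "x > b"
begin

lemma pos_diff: "AE t in M. 0 < x - b \<and> x - b \<le> x - t \<and> x - t \<le> x + b \<and> \<bar>t\<bar> \<le> b"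
  using bounded by eventually_elim (use x in auto)

lemma h_bounded: "AE t in M. \<bar>1 / (x - t)\<bar> \<le> 1 / (x - b)"
  using pos_diff
proof eventually_elim
  case (elim t)
  then show ?case by (auto intro: frac_le)
qed

lemma h_integrable: "integrable M (\<lambda>t. 1 / (x - t))"
  by (rule integrable_bound[where B = "1 / (x - b)"]) (use h_bounded in simp_all)

lemma t_h_integrable: "integrable M (\<lambda>t. t * (1 / (x - t)))"
  by (rule integrable_mult_id[OF _ h_bounded]) measurable

lemma cauchy_transform_of_real: "cauchy_transform M (of_real x) = of_real (G x)"
  unfolding cauchy_transform_kernel kernel_of_real G_def by (rule integral_of_real[OF h_integrable])

text \<open>The tangent line of t |-> 1 / (x - t) at 0 lies below the graph, and t has mean
  0.\<close>

lemma G_ge: "1 / x \<le> G x"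
proof -
  have "1 / x = (\<integral>t. 1 / x + t / x\<^sup>2 \<partial>M)"
    using integrable_id by (simp add: integral_id prob_space[simplified])
  also have "\<dots> \<le> G x"
    unfolding G_def
  proof (rule integral_mono_AE)
    show "AE t in M. 1 / x + t / x\<^sup>2 \<le> 1 / (x - t)"
      using pos_diff
    proof eventually_elim
      case (elim t)
      have "1 / (x - t) - (1 / x + t / x\<^sup>2) = t\<^sup>2 / (x\<^sup>2 * (x - t))"
        using elim x b_pos by (simp add: divide_simps) (simp add: power2_eq_square algebra_simps)
      also have "\<dots> \<ge> 0" using elim by simp
      finally show ?case by simp
    qed
  qed (use integrable_id h_integrable in auto)
  finally show ?thesis .
qed

lemma G_pos: "G x > 0"
  using G_ge x b_pos by (meson dual_order.strict_trans less_le_trans zero_less_divide_1_iff)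

lemma G_le: "G x \<le> 1 / (x - b)"
proof -
  have "G x \<le> (\<integral>t. 1 / (x - b) \<partial>M)"
    unfolding G_def
  proof (rule integral_mono_AE)
    show "AE t in M. 1 / (x - t) \<le> 1 / (x - b)" using h_bounded by eventually_elim linarith
  qed (auto intro: h_integrable)
  then show ?thesis by (simp add: prob_space[simplified])
qed

lemma k_le_b: "k x \<le> b"
  using G_le G_pos x by (simp add: k_def field_simps)

lemma integral_t_h: "(\<integral>t. t * (1 / (x - t)) \<partial>M) = k x * G x"
proof -
  have "(\<integral>t. t * (1 / (x - t)) \<partial>M) = (\<integral>t. x * (1 / (x - t)) - 1 \<partial>M)"
  proof (rule integral_cong_AE)
    show "AE t in M. t * (1 / (x - t)) = x * (1 / (x - t)) - 1"
      using pos_diff by eventually_elim (simp add: field_simps)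
  qed auto
  also have "\<dots> = x * G x - 1"
  proof -
    have "(\<integral>t. x * (1 / (x - t)) - 1 \<partial>M) = (\<integral>t. x * (1 / (x - t)) \<partial>M) - (\<integral>t. 1 \<partial>M)"
      by (rule Bochner_Integration.integral_diff[OF integrable_mult_right[OF h_integrable]]) simp
    then show ?thesis
      by (simp only: integral_mult_right_zero G_def) (simp add: prob_space[simplified])
  qed
  also have "\<dots> = k x * G x" using G_pos by (simp add: k_def field_simps)
  finally show ?thesis .
qed

text \<open>For \<open>f(t) = 1 + c t - t\<^sup>2\<close> the mean is \<open>0\<close>, and if \<open>f\<close> changes sign only once on the support,
  at \<open>t\<^sub>0\<close>, then \<open>f(t) (h(t) - h(t\<^sub>0))\<close> has a constant sign for the increasing function \<open>h(t) = 1 / (x - t)\<close>.\<close>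
lemma integral_quadratic_h:
  shows "integrable M (\<lambda>t. (1 + c * t - t\<^sup>2) * (1 / (x - t) - d))"
    and "(\<integral>t. (1 + c * t - t\<^sup>2) * (1 / (x - t) - d) \<partial>M) = G x * (1 - (x - c) * k x)"
proof -
  have i: "integrable M (\<lambda>t. 1 / (x - t) + (c - x) * (t * (1 / (x - t))) + t - d * (1 + c * t - t\<^sup>2))"
    using h_integrable t_h_integrable integrable_id integrable_sq
    by (intro Bochner_Integration.integrable_diff Bochner_Integration.integrable_add integrable_mult_right) auto
  have ae: "AE t in M. 1 / (x - t) + (c - x) * (t * (1 / (x - t))) + t - d * (1 + c * t - t\<^sup>2) = (1 + c * t - t\<^sup>2) * (1 / (x - t) - d)"
    using pos_diff by eventually_elim (simp add: divide_simps, simp add: power2_eq_square algebra_simps)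
  show "integrable M (\<lambda>t. (1 + c * t - t\<^sup>2) * (1 / (x - t) - d))"
    by (rule integrable_cong_AE_imp[OF i]) (use ae in auto)
  have "(\<integral>t. (1 + c * t - t\<^sup>2) * (1 / (x - t) - d) \<partial>M) =
    (\<integral>t. 1 / (x - t) + (c - x) * (t * (1 / (x - t))) + t - d * (1 + c * t - t\<^sup>2) \<partial>M)"
    by (rule integral_cong_AE) (use ae in auto)
  also have "\<dots> = G x + (c - x) * (k x * G x) + 0 - d * (1 + c * 0 - 1)"
  proof -
    have q: "integrable M (\<lambda>t. 1 + c * t - t\<^sup>2)" "(\<integral>t. 1 + c * t - t\<^sup>2 \<partial>M) = 1 + c * 0 - 1"
      using integrable_id integrable_sq by (simp_all add: integral_id integral_sq prob_space[simplified])
    show ?thesis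
      using h_integrable t_h_integrable integrable_id q(1)
      by (simp only: Bochner_Integration.integral_diff Bochner_Integration.integral_add
         Bochner_Integration.integrable_diff Bochner_Integration.integrable_add
         integrable_mult_right Bochner_Integration.integral_mult_right_zero
         integral_t_h q(2) integral_id G_def[symmetric])
  qed
  also have "\<dots> = G x * (1 - (x - c) * k x)" by (simp add: algebra_simps)
  finally show "(\<integral>t. (1 + c * t - t\<^sup>2) * (1 / (x - t) - d) \<partial>M) = G x * (1 - (x - c) * k x)" .
qed

text \<open>For c = b the roots satisfy t0 < 0 and t1 > b, so on the support only t0 can be a sign
  change and the integrand is non-negative; its integral is G (1 - (x - b) k).\<close>

lemma k_le: "k x \<le> 1 / (x - b)"
proof -
  define r where "r = sqrt (b\<^sup>2 + 4)"
  have r2: "r\<^sup>2 = b\<^sup>2 + 4" by (simp add: r_def)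
  have rb: "r > b" unfolding r_def by (rule real_less_rsqrt) simp
  define t0 t1 where "t0 = (b - r) / 2" and "t1 = (b + r) / 2"
  have factor: "1 + b * t - t\<^sup>2 = (t - t0) * (t1 - t)" for t
    using r2 by (simp add: t0_def t1_def power2_eq_square field_simps)
  have t0: "t0 < 0" "t1 > b" using rb by (auto simp: t0_def t1_def)
  have "0 \<le> (\<integral>t. (1 + b * t - t\<^sup>2) * (1 / (x - t) - 1 / (x - t0)) \<partial>M)"
  proof (rule integral_nonneg_AE)
    show "AE t in M. 0 \<le> (1 + b * t - t\<^sup>2) * (1 / (x - t) - 1 / (x - t0))"
      using pos_diff
    proof eventually_elim
      case (elim t)
      have "1 / (x - t) - 1 / (x - t0) = (t - t0) / ((x - t) * (x - t0))"
        using elim t0 b_pos x by (simp add: field_simps)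
      then have "(1 + b * t - t\<^sup>2) * (1 / (x - t) - 1 / (x - t0)) = (t - t0)\<^sup>2 * (t1 - t) / ((x - t) * (x - t0))"
        unfolding factor by (simp add: power2_eq_square)
      also have "\<dots> \<ge> 0" using elim t0 b_pos x by (intro divide_nonneg_nonneg mult_nonneg_nonneg) auto
      finally show ?case .
    qed
  qed
  then have "0 \<le> G x * (1 - (x - b) * k x)" by (simp only: integral_quadratic_h)
  then have "(x - b) * k x \<le> 1" using G_pos by (simp add: zero_le_mult_iff)
  then show ?thesis using x by (simp add: field_simps)
qed

text \<open>The mirror choice c = -b has roots t1 < -b and t0 > 0, which reverses the sign of the
  integrand.\<close>

lemma k_ge: "1 / (x + b) \<le> k x"
proof -
  define r where "r = sqrt (b\<^sup>2 + 4)"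
  have r2: "r\<^sup>2 = b\<^sup>2 + 4" by (simp add: r_def)
  have rb: "r > b" unfolding r_def by (rule real_less_rsqrt) simp
  define t0 t1 where "t0 = (r - b) / 2" and "t1 = (- b - r) / 2"
  have factor: "1 + (- b) * t - t\<^sup>2 = (t0 - t) * (t - t1)" for t
    using r2 by (simp add: t0_def t1_def power2_eq_square field_simps)
  have t01: "t0 * t0 = 1 - b * t0" "t0 > 0" "t1 < - b"
    using rb r2 by (auto simp: t0_def t1_def power2_eq_square field_simps)
  have t0x: "t0 < x"
  proof (rule ccontr)
    assume "\<not> t0 < x"
    then have "t0 > b" using x by simp
    have "1 \<le> b\<^sup>2"
    proof -
      have "AE t in M. t\<^sup>2 \<le> b\<^sup>2"
        using bounded by eventually_elim (use b_pos in \<open>simp add: abs_le_square_iff[symmetric]\<close>)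
      then have "(\<integral>t. t\<^sup>2 \<partial>M) \<le> (\<integral>t. b\<^sup>2 \<partial>M)" by (intro integral_mono_AE integrable_sq) auto
      then show ?thesis by (simp add: integral_sq prob_space[simplified])
    qed
    moreover have "b\<^sup>2 < t0 * t0" unfolding power2_eq_square using \<open>t0 > b\<close> b_pos by (intro mult_strict_mono) auto
    ultimately show False using t01 b_pos mult_pos_pos[OF b_pos t01(2)] by linarith
  qed
  have "0 \<le> (\<integral>t. - ((1 + (- b) * t - t\<^sup>2) * (1 / (x - t) - 1 / (x - t0))) \<partial>M)"
  proof (rule integral_nonneg_AE)
    show "AE t in M. 0 \<le> - ((1 + (- b) * t - t\<^sup>2) * (1 / (x - t) - 1 / (x - t0)))"
      using pos_diff
    proof eventually_elim
      case (elim t)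
      have "1 / (x - t) - 1 / (x - t0) = (t - t0) / ((x - t) * (x - t0))"
        using elim t0x b_pos x by (simp add: field_simps)
      moreover have "- ((t0 - t) * (t - t1) * ((t - t0) / d)) = (t - t0)\<^sup>2 * (t - t1) / d" for d
      proof -
        have "t0 - t = - (t - t0)" by simp
        then show ?thesis by (simp only: mult_minus_left minus_minus) (simp add: power2_eq_square ac_simps)
      qed
      ultimately have "- ((1 + (- b) * t - t\<^sup>2) * (1 / (x - t) - 1 / (x - t0))) = (t - t0)\<^sup>2 * (t - t1) / ((x - t) * (x - t0))"
        unfolding factor by simp
      also have "\<dots> \<ge> 0" using elim t0x t01 b_pos x by (intro divide_nonneg_nonneg mult_nonneg_nonneg) auto
      finally show ?case .
    qed
  qed
  then have "0 \<le> - (G x * (1 - (x - (- b)) * k x))"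
    by (simp only: integral_quadratic_h Bochner_Integration.integral_minus)
  then have "0 \<le> G x * ((x + b) * k x - 1)" by (simp add: algebra_simps)
  then have "1 \<le> (x + b) * k x" using G_pos by (simp add: zero_le_mult_iff)
  then show ?thesis using x b_pos by (simp add: field_simps)
qed

text \<open>Bessel's inequality for 1 / (x - t), whose coefficients along 1 and t are G and k
  G.\<close>

lemma P_diag_ge: "(G x)\<^sup>2 * (1 + (k x)\<^sup>2) \<le> P x x"
proof -
  have "(\<lambda>t. 1 / (x - t)) \<in> borel_measurable borel" by measurable
  from bessel[OF this h_bounded] have "(G x)\<^sup>2 + (k x * G x)\<^sup>2 \<le> P x x"
    unfolding integral_t_h G_def[symmetric] P_def by (simp add: power2_eq_square)
  then show ?thesis by (simp add: algebra_simps power2_eq_square)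
qed

text \<open>P - G^2 is the variance of 1 / (x - t), at most its second moment about 1 / x. There (1
  / (x - t) - 1 / x)^2 <= t^2 / (x^2 (x - b)^2); the unit second moment and 1 / x <= G
  conclude.\<close>

lemma P_diag_le: "P x x \<le> (G x)\<^sup>2 * (1 + 1 / (x - b)\<^sup>2)"
proof -
  have ae2: "AE t in M. \<bar>1 / (x - t) * (1 / (x - t))\<bar> \<le> 1 / (x - b) * (1 / (x - b))"
    using h_bounded
  proof eventually_elim
    case (elim t)
    show ?case unfolding abs_mult by (rule mult_mono[OF elim elim]) (use x in simp_all)
  qed
  have i2: "integrable M (\<lambda>t. 1 / (x - t) * (1 / (x - t)))"
    by (rule integrable_bound[where B = "1 / (x - b) * (1 / (x - b))"]) (use ae2 in simp_all)
  have "P x x - 2 * (1 / x) * G x + 1 / x\<^sup>2 = (\<integral>t. (1 / (x - t) - 1 / x)\<^sup>2 \<partial>M)"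
  proof -
    have "(\<integral>t. (1 / (x - t) - 1 / x)\<^sup>2 \<partial>M) = (\<integral>t. 1 / (x - t) * (1 / (x - t)) - 2 * (1 / x) * (1 / (x - t)) + 1 / x\<^sup>2 \<partial>M)"
      by (rule Bochner_Integration.integral_cong) (simp_all add: power2_eq_square algebra_simps)
    also have "\<dots> = P x x - 2 * (1 / x) * G x + 1 / x\<^sup>2"
    proof -
      note i1 = integrable_mult_right[OF h_integrable, of "2 * (1 / x)"]
      have "(\<integral>t. 1 / x\<^sup>2 \<partial>M) = 1 / x\<^sup>2" by (simp add: prob_space[simplified])
      then show ?thesis
        unfolding P_def G_def
        by (subst Bochner_Integration.integral_add[OF Bochner_Integration.integrable_diff[OF i2 i1]], simp)
           (simp only: Bochner_Integration.integral_diff[OF i2 i1] integral_mult_right_zero)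
    qed
    finally show ?thesis ..
  qed
  also have "\<dots> \<le> (\<integral>t. t\<^sup>2 * (1 / (x\<^sup>2 * (x - b)\<^sup>2)) \<partial>M)"
  proof (rule integral_mono_AE)
    show "AE t in M. (1 / (x - t) - 1 / x)\<^sup>2 \<le> t\<^sup>2 * (1 / (x\<^sup>2 * (x - b)\<^sup>2))"
      using pos_diff
    proof eventually_elim
      case (elim t)
      have "1 / (x - t) - 1 / x = t / (x * (x - t))" using elim b_pos x by (simp add: field_simps)
      then have "(1 / (x - t) - 1 / x)\<^sup>2 = t\<^sup>2 * (1 / (x\<^sup>2 * (x - t)\<^sup>2))"
        by (simp add: power_divide power_mult_distrib)
      also have "\<dots> \<le> t\<^sup>2 * (1 / (x\<^sup>2 * (x - b)\<^sup>2))"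
        using elim b_pos x by (intro mult_left_mono frac_le power_mono mult_pos_pos) auto
      finally show ?case .
    qed
    have "integrable M (\<lambda>t. 1 / (x - t) * (1 / (x - t)) - 2 * (1 / x) * (1 / (x - t)) + 1 / x\<^sup>2)"
      using i2 integrable_mult_right[OF h_integrable, of "2 * (1 / x)"] by auto
    then show "integrable M (\<lambda>t. (1 / (x - t) - 1 / x)\<^sup>2)"
      by (rule Bochner_Integration.integrable_cong[THEN iffD1, rotated -1]) (simp_all add: power2_eq_square algebra_simps)
  qed (use integrable_sq in simp)
  also have "\<dots> = (1 / x)\<^sup>2 * (1 / (x - b)\<^sup>2)" by (simp add: integral_sq power_divide)
  also have "\<dots> \<le> (G x)\<^sup>2 * (1 / (x - b)\<^sup>2)"
    using G_ge x b_pos by (intro mult_right_mono power_mono) auto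
  finally have "P x x - 2 * (1 / x) * G x + 1 / x\<^sup>2 \<le> (G x)\<^sup>2 * (1 / (x - b)\<^sup>2)" .
  moreover have "2 * (1 / x) * G x - 1 / x\<^sup>2 \<le> (G x)\<^sup>2"
    using zero_le_power2[of "G x - 1 / x"] by (simp add: power2_diff power_divide)
  ultimately show ?thesis by (simp add: distrib_left)
qed

end

end

section \<open>The atom to the right of the support\<close>

context bounded_standardized_distribution
begin

lemma P_of_real:
  assumes "x > b" "x' > b"
  shows "(\<integral>t. cauchy_kernel (of_real x) t * cauchy_kernel (of_real x') t \<partial>M) = of_real (P x x')"
    and "integrable M (\<lambda>t. 1 / (x - t) * (1 / (x' - t)))"
proof -
  have eq: "cauchy_kernel (of_real x) t * cauchy_kernel (of_real x') t = of_real (1 / (x - t) * (1 / (x' - t)))" for t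
    by (simp only: kernel_of_real of_real_mult assms)
  have "integrable M (\<lambda>t. cauchy_kernel (of_real x) t * cauchy_kernel (of_real x') t)"
    by (intro kernel_mult_integrable off_measure_Re) (use assms in auto)
  then show i: "integrable M (\<lambda>t. 1 / (x - t) * (1 / (x' - t)))"
    unfolding eq by (rule complex_of_real_integrable_eq[THEN iffD1])
  show "(\<integral>t. cauchy_kernel (of_real x) t * cauchy_kernel (of_real x') t \<partial>M) = of_real (P x x')"
    unfolding eq P_def by (rule integral_of_real[OF i])
qed

lemma G_diff:
  assumes "x > b" "x' > b"
  shows "G x - G x' = (x' - x) * P x x'"
proof -
  have "of_real (G x - G x') = complex_of_real ((x' - x) * P x x')"
    using cauchy_transform_diff[of "of_real x" "of_real x'"] assms
    by (simp add: off_measure_Re cauchy_transform_of_real P_of_real)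
  then show ?thesis by (simp only: of_real_eq_iff)
qed

text \<open>With \<open>h(t) = 1 / (x - t)\<close> and \<open>h'(t) = 1 / (x' - t)\<close>, both factors of
  \<open>(h(t) - h(t\<^sub>0)) (h'(t) - h'(t\<^sub>0))\<close> have the sign of \<open>t - t\<^sub>0\<close>; the choice \<open>t\<^sub>0 = k x\<close>
  makes \<open>h(t\<^sub>0)\<close> the mean of \<open>h\<close>.\<close>
lemma P_ge:
  assumes x: "x > b" and x': "x' > b"
  shows "G x * G x' \<le> P x x'"
proof -
  define t0 where "t0 = k x"
  have t0: "t0 < x" "t0 < x'" using k_le_b[OF x] x x' by (auto simp: t0_def)
  have c: "1 / (x - t0) = G x" using G_pos[OF x] by (simp add: t0_def k_def)
  define d where "d = 1 / (x' - t0)"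
  note i = P_of_real(2)[OF x x'] integrable_mult_right[OF h_integrable[OF x], of d]
    integrable_mult_right[OF h_integrable[OF x'], of "G x"]
  have eq: "(1 / (x - t) - G x) * (1 / (x' - t) - d) =
      1 / (x - t) * (1 / (x' - t)) - d * (1 / (x - t)) - G x * (1 / (x' - t)) + G x * d" for t
    by (simp add: left_diff_distrib right_diff_distrib mult.commute)
  have "0 \<le> (\<integral>t. (1 / (x - t) - G x) * (1 / (x' - t) - d) \<partial>M)"
  proof (rule integral_nonneg_AE)
    show "AE t in M. 0 \<le> (1 / (x - t) - G x) * (1 / (x' - t) - d)"
      using pos_diff[OF x] pos_diff[OF x']
    proof eventually_elim
      case (elim t)
      have "1 / (x - t) - G x = (t - t0) / ((x - t) * (x - t0))"
        using elim t0 x unfolding c[symmetric] by (simp add: field_simps)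
      moreover have "1 / (x' - t) - d = (t - t0) / ((x' - t) * (x' - t0))"
        using elim t0 x' unfolding d_def by (simp add: field_simps)
      ultimately have "(1 / (x - t) - G x) * (1 / (x' - t) - d) =
          (t - t0)\<^sup>2 / (((x - t) * (x - t0)) * ((x' - t) * (x' - t0)))"
        by (simp add: power2_eq_square)
      also have "\<dots> \<ge> 0" using elim t0 x x' by (intro divide_nonneg_nonneg mult_nonneg_nonneg) auto
      finally show ?case .
    qed
  qed
  also have "\<dots> = P x x' - d * G x - G x * G x' + G x * d"
  proof -
    have "(\<integral>t. G x * d \<partial>M) = G x * d" by (simp add: prob_space[simplified])
    then show ?thesis
      unfolding eq
      by (subst Bochner_Integration.integral_add[OF Bochner_Integration.integrable_diff[OF
            Bochner_Integration.integrable_diff[OF i(1,2)] i(3)]], simp)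
         (simp only: Bochner_Integration.integral_diff[OF Bochner_Integration.integrable_diff[OF i(1,2)] i(3)]
            Bochner_Integration.integral_diff[OF i(1,2)] integral_mult_right_zero G_def[symmetric] P_def[symmetric])
  qed
  finally show ?thesis by (simp add: mult.commute)
qed

text \<open>By the resolvent identity and \<open>P_ge\<close>, 1 / G has slope at least 1, so x - 1
  / G does not increase.\<close>

lemma k_antimono:
  assumes x: "x > b" and le: "x \<le> x'"
  shows "k x' \<le> k x"
proof -
  have x': "x' > b" using x le by simp
  note pos = G_pos[OF x] G_pos[OF x']
  have "1 / G x' - 1 / G x = (G x - G x') / (G x * G x')" using pos by (simp add: field_simps)
  also have "\<dots> = (x' - x) * (P x x' / (G x * G x'))" by (simp add: G_diff[OF x x'])
  also have "\<dots> \<ge> (x' - x) * 1"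
    using P_ge[OF x x'] pos le by (intro mult_left_mono) auto
  finally show ?thesis by (simp add: k_def)
qed

lemma G_continuous: "continuous_on {b<..} G"
proof -
  have "continuous_on {z. Re z > b} (cauchy_transform M)"
    using cauchy_transform_has_derivative[of "{z. Re z > b}"] off_measure_Re open_halfspace_Re_gt
    by (intro continuous_at_imp_continuous_on ballI DERIV_isCont) auto
  then have "continuous_on {b<..} (\<lambda>x. Re (cauchy_transform M (of_real x)))"
    by (intro continuous_intros continuous_on_compose2[of _ "cauchy_transform M" _ of_real]) auto
  then show ?thesis
    by (rule continuous_on_eq) (simp add: cauchy_transform_of_real)
qed

end

text \<open>\<open>s\<close> stands for sqrt n and \<open>R\<close> for the power before dilation.
  Stating only the relation between K-transforms keeps the locale stable under reflection.\<close>

locale boolean_multiple = bounded_standardized_distribution M b for M b +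
  fixes s :: real and R :: "real measure"
  assumes s: "s > b" and R: "borel_prob R"
    and K_R: "\<And>z. Im z > 0 \<Longrightarrow> K_transform R z = of_real (s\<^sup>2) * K_transform M z"
begin

sublocale R: borel_distribution R
  using R by (simp add: borel_prob_iff)

lemma s_pos: "s > 0" using s b_pos by simp

definition \<phi> :: "real \<Rightarrow> real" where "\<phi> x = x - s\<^sup>2 * k x"
definition \<Phi> :: "complex \<Rightarrow> complex" where
  "\<Phi> z = z - of_real (s\<^sup>2) * (z - 1 / cauchy_transform M z)"
text \<open>The derivative of \<open>\<phi>\<close>, written out by means of \<open>- P x x\<close>
  for the derivative of \<open>G\<close>.\<close>

definition slope :: "real \<Rightarrow> real" where
  "slope x = 1 + s\<^sup>2 * (P x x / (G x)\<^sup>2 - 1)"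

lemma cauchy_R: "Im z > 0 \<Longrightarrow> cauchy_transform R z = 1 / \<Phi> z"
  using K_R[of z] by (simp add: K_transform_def F_transform_def \<Phi>_def field_simps)

lemma \<Phi>_of_real: "x > b \<Longrightarrow> \<Phi> (of_real x) = of_real (\<phi> x)"
  by (simp add: \<Phi>_def \<phi>_def k_def cauchy_transform_of_real)

lemma approach:
  assumes x: "x > b" and u: "\<And>n. u n > 0" "u \<longlonglongrightarrow> 0"
  shows "(\<lambda>n. cauchy_transform M (of_real x + \<i> * of_real (u n))) \<longlonglongrightarrow> of_real (G x)"
    and "(\<lambda>n. \<integral>t. cauchy_kernel (of_real x + \<i> * of_real (u n)) t * cauchy_kernel (of_real x) t \<partial>M) \<longlonglongrightarrow> of_real (P x x)"
proof -
  have lim: "(\<lambda>n. of_real x + \<i> * of_real (u n)) \<longlonglongrightarrow> complex_of_real x"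
    using tendsto_add[OF tendsto_const tendsto_mult[OF tendsto_const tendsto_of_real[OF u(2)]], of "of_real x" \<i>] by simp
  have off: "off_measure M (of_real x)" "off_measure M (of_real x + \<i> * of_real (u n))" for n
    using x by (auto intro!: off_measure_Re)
  show "(\<lambda>n. cauchy_transform M (of_real x + \<i> * of_real (u n))) \<longlonglongrightarrow> of_real (G x)"
    using tendsto_cauchy_transform[OF off lim] by (simp add: cauchy_transform_of_real[OF x])
  show "(\<lambda>n. \<integral>t. cauchy_kernel (of_real x + \<i> * of_real (u n)) t * cauchy_kernel (of_real x) t \<partial>M) \<longlonglongrightarrow> of_real (P x x)"
    using tendsto_kernel_mult[OF off(1) off(1) lim] by (simp add: P_of_real[OF x x])
qed

text \<open>The boundary value of the Cauchy transform of \<open>R\<close> is the real number 1 /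
  \<open>\<phi> x\<close>.\<close>

lemma null_near_nonzero:
  assumes x: "x > b" and ne: "\<phi> x \<noteq> 0" and u: "\<And>n. u n > 0" "u \<longlonglongrightarrow> 0"
  shows "(\<lambda>n. Im (cauchy_transform R (of_real x + \<i> * of_real (u n)))) \<longlonglongrightarrow> 0"
proof -
  have "(\<lambda>n. \<Phi> (of_real x + \<i> * of_real (u n))) \<longlonglongrightarrow>
      (of_real x + \<i> * of_real 0) - of_real (s\<^sup>2) * ((of_real x + \<i> * of_real 0) - 1 / of_real (G x))"
    unfolding \<Phi>_def by (intro tendsto_intros approach x u) (use G_pos[OF x] in auto)
  also have "(of_real x + \<i> * of_real 0) - of_real (s\<^sup>2) * ((of_real x + \<i> * of_real 0) - 1 / of_real (G x))
      = complex_of_real (\<phi> x)" by (simp add: \<phi>_def k_def)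
  finally have "(\<lambda>n. Im (1 / \<Phi> (of_real x + \<i> * of_real (u n)))) \<longlonglongrightarrow> Im (1 / of_real (\<phi> x))"
    by (intro tendsto_intros) (use ne in auto)
  then show ?thesis using u(1) by (simp add: cauchy_R)
qed

lemma slope_ge_1: "x > b \<Longrightarrow> slope x \<ge> 1"
  using P_ge[of x x] G_pos[of x] by (simp add: slope_def power2_eq_square)

text \<open>The transform of \<open>R\<close> is 1 / \<open>\<Phi>\<close>. As \<open>\<Phi>\<close>
  vanishes at x, the resolvent identity factors its value at x + i u as i u times a divided
  difference \<open>D n\<close>, which tends to the slope; \<open>atom_limit\<close> then reads off
  the mass.\<close>

lemma measure_atom:
  assumes x: "x > b" and zero: "\<phi> x = 0"
  shows "measure R {x} = 1 / slope x"
proof -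
  define u where "u n = 1 / real (Suc n)" for n
  have u: "\<And>n. u n > 0" "u \<longlonglongrightarrow> 0" unfolding u_def by (simp, real_asymp)
  define D where "D n = 1 + of_real (s\<^sup>2) * ((\<integral>t. cauchy_kernel (of_real x + \<i> * of_real (u n)) t * cauchy_kernel (of_real x) t \<partial>M) /
     (cauchy_transform M (of_real x + \<i> * of_real (u n)) * of_real (G x)) - 1)" for n
  have Gx: "G x > 0" by (rule G_pos[OF x])
  have "D \<longlonglongrightarrow> 1 + of_real (s\<^sup>2) * (of_real (P x x) / (of_real (G x) * of_real (G x)) - 1)"
    unfolding D_def using Gx by (intro tendsto_intros approach x u) auto
  also have "1 + of_real (s\<^sup>2) * (of_real (P x x) / (of_real (G x) * of_real (G x)) - 1) = complex_of_real (slope x)"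
    by (simp add: slope_def power2_eq_square)
  finally have D: "D \<longlonglongrightarrow> complex_of_real (slope x)" .
  have "\<i> * of_real (u n) * cauchy_transform R (of_real x + \<i> * of_real (u n)) = 1 / D n" for n
  proof -
    let ?z = "of_real x + \<i> * of_real (u n)"
    let ?g = "cauchy_transform M ?z" and ?p = "\<integral>t. cauchy_kernel ?z t * cauchy_kernel (of_real x) t \<partial>M"
    have z: "Im ?z > 0" using u(1) by simp
    have g: "?g \<noteq> 0" by (rule cauchy_transform_nonzero[OF z])
    have "?g - of_real (G x) = (of_real x - ?z) * ?p"
      using cauchy_transform_diff[of ?z "of_real x"] x
      by (simp add: off_measure_Re cauchy_transform_of_real)
    then have gd: "of_real (G x) - ?g = \<i> * of_real (u n) * ?p" by (simp add: algebra_simps)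
    have "1 / ?g - 1 / of_real (G x) = (of_real (G x) - ?g) / (?g * of_real (G x))"
      using g Gx by (simp add: field_simps)
    then have "1 / ?g - 1 / of_real (G x) = \<i> * of_real (u n) * (?p / (?g * of_real (G x)))"
      unfolding gd by simp
    moreover have "\<Phi> ?z = \<Phi> ?z - \<Phi> (of_real x)" using \<Phi>_of_real[OF x] zero by simp
    then have "\<Phi> ?z = \<i> * of_real (u n) - of_real (s\<^sup>2) * (\<i> * of_real (u n) - (1 / ?g - 1 / of_real (G x)))"
      by (simp add: \<Phi>_def cauchy_transform_of_real[OF x] algebra_simps)
    ultimately have "\<Phi> ?z = \<i> * of_real (u n) * D n"
      by (simp add: D_def algebra_simps)
    then show ?thesis using u(1)[of n] by (simp add: cauchy_R[OF z])
  qed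
  then have "(\<lambda>n. 1 / D n) \<longlonglongrightarrow> of_real (measure R {x})"
    using R.atom_limit[OF u, of x] by simp
  moreover have "(\<lambda>n. 1 / D n) \<longlonglongrightarrow> 1 / of_real (slope x)"
    using slope_ge_1[OF x] by (intro tendsto_intros D) auto
  ultimately have "complex_of_real (measure R {x}) = of_real (1 / slope x)"
    using LIMSEQ_unique by fastforce
  then show ?thesis by (simp only: of_real_eq_iff)
qed

lemma \<phi>_strict_mono: "\<lbrakk>x > b; x < x'\<rbrakk> \<Longrightarrow> \<phi> x < \<phi> x'"
  using mult_left_mono[OF k_antimono[of x x'], of "s\<^sup>2"] by (simp add: \<phi>_def)

lemma \<phi>_continuous: "continuous_on {b<..} \<phi>"
  unfolding \<phi>_def k_def
  by (intro continuous_intros G_continuous) (use G_pos in fastforce)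

text \<open>At s + b the bound \<open>k_le\<close> reads k <= 1 / s, and at s - b the bound
  \<open>k_ge\<close> reads k >= 1 / s. The window of radius b around s comes from these two
  evaluations.\<close>

lemma \<phi>_pos: "\<phi> (s + b) > 0"
proof -
  have "s\<^sup>2 * k (s + b) \<le> s\<^sup>2 * (1 / (s + b - b))"
    using k_le[of "s + b"] s_pos b_pos by (intro mult_left_mono) auto
  also have "\<dots> = s" using s_pos by (simp add: power2_eq_square)
  finally show ?thesis using b_pos by (simp add: \<phi>_def)
qed

lemma \<phi>_nonpos: "s - b > b \<Longrightarrow> \<phi> (s - b) \<le> 0"
proof -
  assume sb: "s - b > b"
  have "s = s\<^sup>2 * (1 / (s - b + b))" using s_pos by (simp add: power2_eq_square)
  also have "\<dots> \<le> s\<^sup>2 * k (s - b)"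
    using k_ge[OF sb] by (intro mult_left_mono) auto
  finally show ?thesis using b_pos by (simp add: \<phi>_def)
qed

text \<open>The form covers two cases: \<open>X\<close> the only zero on the half line, or, with X =
  b, no zero at all.\<close>

lemma null_of_no_zero:
  assumes X: "\<And>x. \<lbrakk>x > b; x \<noteq> X\<rbrakk> \<Longrightarrow> \<phi> x \<noteq> 0"
  shows "measure R ({b<..} - {X}) = 0"
proof -
  have "emeasure R ({b<..} - {X}) = 0"
  proof (rule emeasure_open_locally_null)
    show "open ({b<..} - {X})" by (simp add: open_Diff)
    fix x assume "x \<in> {b<..} - {X}"
    then obtain e where e: "e > 0" "ball x e \<subseteq> {b<..} - {X}"
      using openE[OF \<open>open ({b<..} - {X})\<close>] by blast
    have "measure R {x - e/2<..x + e/2} = 0"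
    proof (rule R.interval_null_of_cauchy_boundary[of "x - e" "x + e"])
      fix y u assume y: "x - e < y" "y < x + e" and u: "\<And>n. u n > (0::real)" "u \<longlonglongrightarrow> 0"
      have "y \<in> {b<..} - {X}" using y e(2) by (auto simp: subset_iff dist_real_def)
      then show "(\<lambda>n. Im (cauchy_transform R (of_real y + \<i> * of_real (u n)))) \<longlonglongrightarrow> 0"
        using X u by (intro null_near_nonzero) auto
    qed (use e in auto)
    moreover have "measure R (ball x (e/2)) \<le> measure R {x - e/2<..x + e/2}"
      by (intro R.finite_measure_mono) (auto simp: ball_eq_greaterThanLessThan)
    ultimately show "\<exists>e>0. emeasure R (ball x e) = 0"
      using e(1) by (intro exI[of _ "e/2"]) (simp add: R.emeasure_eq_measure measure_le_0_iff)
  qed simp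
  then show ?thesis by (simp add: measure_def)
qed

text \<open>The diagonal estimates for \<open>P\<close> bound the slope at the zero X and hence the
  mass 1 / slope: \<open>P_diag_ge\<close> with k X = X / s^2 bounds the mass from above,
  \<open>P_diag_le\<close> from below.\<close>

theorem right_atom:
  "\<exists>X. b < X \<and> s - b \<le> X \<and> X \<le> s + b \<and> measure R ({b<..} - {X}) = 0
     \<and> measure R {X} \<le> 1/2 + b / (2 * s) \<and> 1/2 - 2 * b / s < measure R {X}"
proof (cases "\<exists>X>b. \<phi> X = 0")
  case True
  then obtain X where X: "X > b" "\<phi> X = 0" by blast
  have "X \<le> s + b"
    using \<phi>_strict_mono[of "s + b" X] \<phi>_pos X s_pos b_pos by (cases "X \<le> s + b") auto
  moreover have sX: "s - b \<le> X"
    using \<phi>_strict_mono[of X "s - b"] \<phi>_nonpos X by (cases "s - b \<le> X") auto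
  moreover have "measure R ({b<..} - {X}) = 0"
  proof (rule null_of_no_zero)
    fix x assume "x > b" "x \<noteq> X"
    then show "\<phi> x \<noteq> 0" using \<phi>_strict_mono[of x X] \<phi>_strict_mono[of X x] X by (cases "x < X") auto
  qed
  moreover have m: "measure R {X} = 1 / slope X" by (rule measure_atom[OF X])
  have Gp: "(G X)\<^sup>2 > 0" using G_pos[OF X(1)] by simp
  have "measure R {X} \<le> 1/2 + b / (2 * s)"
  proof -
    have kX: "k X = X / s\<^sup>2" using X(2) s_pos by (simp add: \<phi>_def field_simps)
    have "1 + (k X)\<^sup>2 \<le> P X X / (G X)\<^sup>2"
      using P_diag_ge[OF X(1)] Gp by (simp add: le_divide_eq mult.commute)
    then have "s\<^sup>2 * (k X)\<^sup>2 \<le> s\<^sup>2 * (P X X / (G X)\<^sup>2 - 1)" by (intro mult_left_mono) auto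
    moreover have "s\<^sup>2 * (k X)\<^sup>2 = X\<^sup>2 / s\<^sup>2" using s_pos by (simp add: kX power2_eq_square)
    ultimately have sl: "1 + X\<^sup>2 / s\<^sup>2 \<le> slope X" by (simp add: slope_def)
    have "measure R {X} \<le> 1 / (1 + X\<^sup>2 / s\<^sup>2)"
      unfolding m using sl slope_ge_1[OF X(1)] by (intro divide_left_mono mult_pos_pos) (auto intro: add_pos_nonneg)
    also have "\<dots> \<le> 1/2 + b / (2 * s)"
    proof (rule atom_upper_numeric)
      have "1 / (X + b) \<le> X / s\<^sup>2" using k_ge[OF X(1)] kX by simp
      then show "s\<^sup>2 \<le> X\<^sup>2 + b * X" using X b_pos s_pos by (simp add: field_simps power2_eq_square)
    qed (use X b_pos s in auto)
    finally show ?thesis .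
  qed
  moreover have "1/2 - 2 * b / s < measure R {X}"
  proof (cases "b \<le> s / 4")
    case True
    have "P X X / (G X)\<^sup>2 \<le> 1 + 1 / (X - b)\<^sup>2"
      using P_diag_le[OF X(1)] Gp by (simp add: divide_le_eq mult.commute)
    then have "s\<^sup>2 * (P X X / (G X)\<^sup>2 - 1) \<le> s\<^sup>2 * (1 / (X - b)\<^sup>2)" by (intro mult_left_mono) auto
    then have "slope X \<le> 1 + s\<^sup>2 / (X - b)\<^sup>2" by (simp add: slope_def)
    then have "1 / (1 + s\<^sup>2 / (X - b)\<^sup>2) \<le> measure R {X}"
      unfolding m using slope_ge_1[OF X(1)] by (intro divide_left_mono mult_pos_pos) auto
    then show ?thesis using atom_lower_numeric[OF b_pos s_pos True sX] by simp
  next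
    case False
    then have "1/2 - 2 * b / s < 0" using s_pos by (simp add: field_simps)
    then show ?thesis using measure_nonneg[of R "{X}"] by linarith
  qed
  ultimately show ?thesis using X by blast
next
  case False
  \<comment> \<open>Without a zero, the intermediate value theorem forces b > s / 4, where the
    required lower bound is negative; s + b then serves as a placeholder atom of mass 0.\<close>
  have null: "measure R {b<..} = 0"
    using null_of_no_zero[of b] False by fastforce
  have X: "s + b > b" using s_pos by simp
  have "\<not> b \<le> s / 4"
  proof
    assume "b \<le> s / 4"
    then have sb: "s - b > b" using s_pos b_pos by simp
    have "\<exists>x\<ge>s - b. x \<le> s + b \<and> \<phi> x = 0"
      by (rule IVT') (use \<phi>_nonpos[OF sb] \<phi>_pos b_pos sb in \<open>auto intro: continuous_on_subset[OF \<phi>_continuous]\<close>)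
    then show False using False sb by force
  qed
  then have "1/2 - 2 * b / s < 0" using s_pos by (simp add: field_simps)
  moreover have "measure R {s + b} = 0" "measure R ({b<..} - {s + b}) = 0"
    using null R.finite_measure_mono[of "{s + b}" "{b<..}"] R.finite_measure_mono[of "{b<..} - {s + b}" "{b<..}"] s_pos
    by (auto simp: measure_le_0_iff)
  ultimately show ?thesis using s_pos b_pos by (intro exI[of _ "s + b"]) auto
qed

end

section \<open>Reflection and dilation\<close>

lemma borel_prob_dilate: "borel_prob M \<Longrightarrow> borel_prob (dilate a M)"
  unfolding borel_prob_def dilate_def
  by (auto intro!: prob_space.prob_space_distr cong: measurable_cong_sets)

lemma measure_dilate:
  assumes "borel_prob M" "A \<in> sets borel"
  shows "measure (dilate a M) A = measure M {x. a * x \<in> A}"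
proof -
  have "sets M = sets borel" using assms by (simp add: borel_prob_def)
  then have "space M = UNIV" "(\<lambda>x. a * x) \<in> measurable M borel"
    using sets_eq_imp_space_eq[of M borel] by (auto cong: measurable_cong_sets)
  then show ?thesis using assms(2) by (simp add: dilate_def measure_distr vimage_def)
qed

lemma integral_dilate:
  fixes f :: "real \<Rightarrow> 'a::{banach,second_countable_topology}"
  assumes "borel_prob M" "f \<in> borel_measurable borel"
  shows "(\<integral>x. f x \<partial>dilate a M) = (\<integral>x. f (a * x) \<partial>M)"
proof -
  have "(\<lambda>x. a * x) \<in> measurable M borel"
    using assms by (auto simp: borel_prob_def cong: measurable_cong_sets)
  then show ?thesis unfolding dilate_def using assms(2) by (rule integral_distr)
qed

text \<open>Pointwise, 1 / (z + t) = - cnj (1 / (- cnj z - t)), and z |-> - cnj z preserves the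
  upper half plane.\<close>

lemma K_transform_reflect:
  assumes M: "borel_prob M"
  shows "K_transform (dilate (-1) M) z = - cnj (K_transform M (- cnj z))"
proof -
  have "cauchy_transform (dilate (-1) M) z = (\<integral>t. cauchy_kernel z (-1 * t) \<partial>M)"
    unfolding cauchy_transform_kernel by (rule integral_dilate[OF M]) measurable
  also have "\<dots> = (\<integral>t. - cnj (cauchy_kernel (- cnj z) t) \<partial>M)"
  proof (rule Bochner_Integration.integral_cong)
    fix t
    have "- z - of_real t = - (z + of_real t)" by simp
    then show "cauchy_kernel z (-1 * t) = - cnj (cauchy_kernel (- cnj z) t)"
      unfolding cauchy_kernel_def by (simp only: complex_cnj_divide complex_cnj_diff complex_cnj_minus complex_cnj_cnj
          complex_cnj_one complex_cnj_complex_of_real divide_minus_right minus_minus) simp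
  qed simp
  also have "\<dots> = - cnj (cauchy_transform M (- cnj z))"
    by (simp add: cauchy_transform_kernel)
  finally show ?thesis by (simp add: K_transform_def F_transform_def)
qed

text \<open>Lets \<open>right_atom\<close> for the reflected pair supply the atom to the left of the
  support.\<close>

lemma boolean_multiple_reflect:
  assumes "boolean_multiple M b s R"
  shows "boolean_multiple (dilate (-1) M) b s (dilate (-1) R)"
proof -
  interpret boolean_multiple M b s R by (rule assms)
  have M: "borel_prob M" by (simp add: borel_prob_iff borel_distribution_axioms)
  have m: "moment (dilate (-1) M) j = (\<integral>t. (- t) ^ j \<partial>M)" for j
    unfolding moment_def by (subst integral_dilate[OF M]) simp_all
  have ae: "AE t in dilate (-1) M. \<bar>t\<bar> \<le> b"
    unfolding dilate_def by (subst AE_distr_iff) (use bounded in auto)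
  interpret M': borel_distribution "dilate (-1) M"
    using borel_prob_dilate[OF M] by (simp add: borel_prob_iff)
  show ?thesis
  proof
    show "moment (dilate (- 1) M) 1 = 0" using integral_id by (simp add: m)
    show "moment (dilate (- 1) M) 2 = 1" using integral_sq by (simp add: m)
    show "b > 0" "s > b" by (fact b_pos s)+
    show "borel_prob (dilate (- 1) R)" by (rule borel_prob_dilate[OF R])
    show "K_transform (dilate (- 1) R) z = of_real (s\<^sup>2) * K_transform (dilate (- 1) M) z" if "Im z > 0" for z
      using that K_R[of "- cnj z"] by (simp add: K_transform_reflect M R)
  qed (fact ae)
qed

section \<open>Supports and the Levy distance to the symmetric Bernoulli law\<close>

lemma AE_of_msupport:
  assumes M: "borel_prob M" and sub: "msupport M \<subseteq> {-b..b}"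
  shows "AE t in M. \<bar>t\<bar> \<le> b"
proof (rule AE_I)
  have sets: "sets M = sets borel" using M by (simp add: borel_prob_def)
  show "{x \<in> space M. \<not> \<bar>x\<bar> \<le> b} \<subseteq> - {-b..b}" by auto
  show "- {-b..b} \<in> sets M" by (simp add: sets)
  show "emeasure M (- {-b..b}) = 0"
  proof (rule emeasure_open_locally_null[OF sets])
    fix x assume "x \<in> - {-b..b}"
    then have "x \<notin> msupport M" using sub by auto
    then show "\<exists>e>0. emeasure M (ball x e) = 0" by (auto simp: msupport_def)
  qed (simp add: open_Compl)
qed

lemma msupport_subset_closed:
  assumes "sets M = sets borel" "closed C" "emeasure M (- C) = 0"
  shows "msupport M \<subseteq> C"
proof
  fix x assume x: "x \<in> msupport M"
  show "x \<in> C"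
  proof (rule ccontr)
    assume "x \<notin> C"
    then obtain e where e: "e > 0" "ball x e \<subseteq> - C"
      using assms(2) openE[of "- C" x] by (auto simp: open_Compl)
    have "emeasure M (ball x e) \<le> emeasure M (- C)"
      using e(2) assms by (intro emeasure_mono) auto
    then show False using x e(1) assms(3) by (auto simp: msupport_def)
  qed
qed

lemma measure_bern_sym:
  "measure bern_sym {..x} = (if x < -1 then 0 else if x < 1 then 1/2 else 1)"
proof -
  have "({-1, 1} \<inter> {..x}) = (if x < -1 then {} else if x < 1 then {-1} else {-1, 1})" by auto
  then show ?thesis
    by (simp add: bern_sym_def measure_pmf_of_set)
qed

text \<open>The Bernoulli distribution function is constant on three ranges of x. In the outer two,
  a shift by 2 e passes every point of the carrier and gives 0 or 1. In the middle one,
  \<open>x1\<close> lies left of x + 2 e and \<open>x2\<close> right of x - 2 e, and the same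
  tolerance absorbs the weight error 2 e.\<close>

lemma levy_dist_bern_sym_le:
  assumes N: "borel_prob N" and e: "e > 0"
    and null: "measure N (- ({-e..e} \<union> {x1, x2})) = 0"
    and x1: "\<bar>-1 - x1\<bar> \<le> e" and x2: "\<bar>1 - x2\<bar> \<le> e"
    and p: "measure N {x1} \<ge> 1/2 - 2 * e" and q: "measure N {x2} \<ge> 1/2 - 2 * e"
  shows "levy_dist N bern_sym \<le> 2 * e"
proof -
  interpret borel_distribution N using N by (simp add: borel_prob_iff)
  let ?C = "{-e..e} \<union> {x1, x2}"
  have C: "?C \<in> sets borel" by auto
  have nullI: "measure N A = 0" if "A \<subseteq> - ?C" for A
    using finite_measure_mono[OF that] null C by (simp add: measure_le_0_iff)
  have comp: "measure N (- A) = 1 - measure N A" if "A \<in> sets borel" for A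
    using prob_compl[of A] that by (simp add: Compl_eq_Diff_UNIV)
  have "measure N {..x - 2 * e} - 2 * e \<le> measure bern_sym {..x} \<and>
      measure bern_sym {..x} \<le> measure N {..x + 2 * e} + 2 * e" for x
  proof -
    consider "x < -1" | "-1 \<le> x" "x < 1" | "1 \<le> x" by linarith
    then show ?thesis
    proof cases
      case 1
      then have "measure N {..x - 2 * e} = 0" using e x1 x2 by (intro nullI) auto
      then show ?thesis using 1 e by (simp add: measure_bern_sym add_nonneg_nonneg)
    next
      case 2
      have "measure N {..x - 2 * e} \<le> measure N (- {x2})"
        using 2 x2 e by (intro finite_measure_mono) auto
      moreover have "measure N {x1} \<le> measure N {..x + 2 * e}"
        using 2 x1 e by (intro finite_measure_mono) auto
      ultimately show ?thesis using 2 p q comp[of "{x2}"] by (simp add: measure_bern_sym)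
    next
      case 3
      have "measure N (- {..x + 2 * e}) = 0" using 3 e x1 x2 by (intro nullI) auto
      then have "measure N {..x + 2 * e} = 1" using comp[of "{..x + 2 * e}"] by simp
      moreover have "measure N {..x - 2 * e} - 2 * e \<le> 1"
        using e prob_le_1[of "{..x - 2 * e}"] by linarith
      ultimately show ?thesis using 3 e by (simp add: measure_bern_sym)
    qed
  qed
  then show ?thesis
    unfolding levy_dist_def using e by (intro cInf_lower bdd_belowI[of _ 0]) auto
qed

section \<open>Rescaling and combination of the two atoms\<close>

theorem theorem2:
  fixes \<mu> :: "real measure" and K :: real and n :: nat
  assumes "borel_prob \<mu>"
    and "moment \<mu> 1 = 0" and "moment \<mu> 2 = 1"
    and "K > 0" and "msupport \<mu> \<subseteq> {-K..K}"
    and "n \<ge> 1" and "sqrt n > K"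
  defines "\<mu>n \<equiv> dilate (1 / sqrt n) (boolean_power \<mu> n)"
  shows "(\<exists>x1 x2. msupport \<mu>n \<subseteq> {-K / sqrt n..K / sqrt n} \<union> {x1, x2}
      \<and> \<bar>-1 - x1\<bar> \<le> K / sqrt n \<and> \<bar>1 - x2\<bar> \<le> K / sqrt n
      \<and> measure \<mu>n {x1} \<in> {1/2 - 2 * K / sqrt n .. 1/2 + K / (2 * sqrt n)}
      \<and> measure \<mu>n {x2} \<in> {1/2 - 2 * K / sqrt n .. 1/2 + K / (2 * sqrt n)}
      \<and> measure \<mu>n {-K / sqrt n..K / sqrt n} < 4 * K / sqrt n)
      \<and> levy_dist \<mu>n bern_sym \<le> 2 * K / sqrt n"
proof -
  define s where "s = sqrt (real n)"
  define R where "R = boolean_power \<mu> n"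
  have s: "s > K" "s > 0" "s\<^sup>2 = real n" using assms by (auto simp: s_def)
  interpret M: borel_distribution \<mu> using assms(1) by (simp add: borel_prob_iff)
  interpret M: standardized_distribution \<mu> by unfold_locales (fact assms)+
  interpret B: boolean_multiple \<mu> K s R
    using M.boolean_power_K_transform[of n] AE_of_msupport[OF assms(1,5)] assms(4) s
    by unfold_locales (auto simp: R_def)
  interpret B': boolean_multiple "dilate (-1) \<mu>" K s "dilate (-1) R"
    by (rule boolean_multiple_reflect) (rule B.boolean_multiple_axioms)
  obtain X where X: "K < X" "s - K \<le> X" "X \<le> s + K" "measure R ({K<..} - {X}) = 0"
    "measure R {X} \<le> 1/2 + K / (2 * s)" "1/2 - 2 * K / s < measure R {X}"
    using B.right_atom by blast
  obtain Y where Y: "K < Y" "s - K \<le> Y" "Y \<le> s + K" "measure (dilate (-1) R) ({K<..} - {Y}) = 0"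
    "measure (dilate (-1) R) {Y} \<le> 1/2 + K / (2 * s)" "1/2 - 2 * K / s < measure (dilate (-1) R) {Y}"
    using B'.right_atom by blast
  have "{x. -1 * x \<in> {K<..} - {Y}} = {..<-K} - {-Y}" "{x. -1 * x \<in> {Y}} = {-Y}" by auto
  then have reflect: "measure (dilate (-1) R) ({K<..} - {Y}) = measure R ({..<-K} - {-Y})"
      "measure (dilate (-1) R) {Y} = measure R {-Y}"
    by (simp_all only: measure_dilate[OF B.R] sets.Diff borel_open[OF open_greaterThan] borel_singleton sets.empty_sets sets.insert_in_sets)
  have \<mu>n: "\<mu>n = dilate (1 / s) R" by (simp add: \<mu>n_def s_def R_def)
  have bp: "borel_prob \<mu>n" unfolding \<mu>n by (rule borel_prob_dilate[OF B.R])
  interpret N: borel_distribution \<mu>n using bp by (simp add: borel_prob_iff)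
  \<comment> \<open>Dilation by 1 / s sends -Y and X to \<open>x1\<close> and \<open>x2\<close>, and
    turns the radius K around -s, 0 and s into \<open>e\<close> around -1, 0 and 1.\<close>
  define e x1 x2 where "e = K / s" and "x1 = - Y / s" and "x2 = X / s"
  have e: "e > 0" "- K / s = - e" using assms(4) s by (auto simp: e_def)
  have meas: "measure \<mu>n A = measure R {x. x / s \<in> A}" if "A \<in> sets borel" for A
    using measure_dilate[OF B.R that, of "1 / s"] by (simp add: \<mu>n)
  have "{x. x / s \<in> {x1}} = {-Y}" "{x. x / s \<in> {x2}} = {X}"
    using s by (auto simp: x1_def x2_def field_simps)
  then have p: "measure \<mu>n {x1} = measure R {-Y}" and q: "measure \<mu>n {x2} = measure R {X}"
    by (simp_all only: meas borel_singleton sets.empty_sets)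
  have x1: "\<bar>-1 - x1\<bar> \<le> e" and x2: "\<bar>1 - x2\<bar> \<le> e" and out: "x1 < - e" "e < x2"
    using X Y s by (auto simp: x1_def x2_def e_def abs_le_iff field_simps)
  have null: "measure \<mu>n (- ({-e..e} \<union> {x1, x2})) = 0"
  proof -
    have sub: "{x. x / s \<in> - ({-e..e} \<union> {x1, x2})} \<subseteq> ({K<..} - {X}) \<union> ({..<-K} - {-Y})"
      using s by (auto simp: x1_def x2_def e_def field_simps)
    have "measure \<mu>n (- ({-e..e} \<union> {x1, x2})) = measure R {x. x / s \<in> - ({-e..e} \<union> {x1, x2})}"
      by (rule meas) auto
    also have "\<dots> \<le> measure R (({K<..} - {X}) \<union> ({..<-K} - {-Y}))"
      by (intro B.R.finite_measure_mono sub) auto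
    also have "\<dots> \<le> measure R ({K<..} - {X}) + measure R ({..<-K} - {-Y})"
      by (intro measure_Un_le) auto
    finally show ?thesis using X(4) Y(4) reflect by (simp add: measure_le_0_iff)
  qed
  have supp: "msupport \<mu>n \<subseteq> {-e..e} \<union> {x1, x2}"
    using null by (intro msupport_subset_closed) (auto simp: N.emeasure_eq_measure)
  have pq: "measure \<mu>n {x1} \<le> 1/2 + K / (2 * s)" "1/2 - 2 * e < measure \<mu>n {x1}"
      "measure \<mu>n {x2} \<le> 1/2 + K / (2 * s)" "1/2 - 2 * e < measure \<mu>n {x2}"
    using X Y reflect by (auto simp: p q e_def)
  \<comment> \<open>The remaining mass is at most 1 minus both weights, each strictly above 1/2 - 2
    e; hence the strict inequality.\<close>
  have r: "measure \<mu>n {-e..e} < 4 * e"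
  proof -
    have "measure \<mu>n ({x1} \<union> {x2}) = measure \<mu>n {x1} + measure \<mu>n {x2}"
      using out e by (intro N.finite_measure_Union) auto
    moreover have "measure \<mu>n ({-e..e} \<union> ({x1} \<union> {x2})) = measure \<mu>n {-e..e} + measure \<mu>n ({x1} \<union> {x2})"
      using out e by (intro N.finite_measure_Union) auto
    ultimately have "measure \<mu>n {-e..e} + (measure \<mu>n {x1} + measure \<mu>n {x2}) = measure \<mu>n ({-e..e} \<union> ({x1} \<union> {x2}))"
      by simp
    also have "\<dots> \<le> 1" by (rule N.prob_le_1)
    finally show ?thesis using pq by linarith
  qed
  have "levy_dist \<mu>n bern_sym \<le> 2 * e"
    using pq by (intro levy_dist_bern_sym_le[OF bp e(1) null x1 x2]) auto
  then show ?thesis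
    using supp x1 x2 pq r unfolding s_def[symmetric] e(2)
    by (intro conjI exI[of _ x1] exI[of _ x2]) (auto simp: e_def)
qed

end
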